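(* Let $G$ be a graph. Then $\xi_{\mathrm{tr}}(G)\le\chi_{\mathrm{qc}}(G)$.
   Context: Graphs $G=(V,E)$ are finite, simple and undirected. Tracial rank: $\xi_{\mathrm{tr}}(G)$ is the reciprocal of the supremum of the set of real numbers $u$ for which there exist a unital C*-algebra $\mathcal A$, a tracial state $s$ on $\mathcal A$ (a state with $s(xy)=s(yx)$ for all $x,y\in\mathcal A$) and projections $e_v\in\mathcal A$, $v\in V$, such that $e_ve_w=0$ whenever $(v,w)\in E$ and $s(e_v)=u$ for every $v\in V$. Commuting quantum chromatic number: with $n=|V|$, $C_{\mathrm{qc}}(n,c)$ is the set of all matrices $(p(i,j|v,w))_{v,i,w,j}$ ($v,w\in V$, $1\le i,j\le c$) of the form $p(i,j|v,w)=\langle E_{v,i}F_{w,j}\xi,\xi\rangle$, where $E_{v,i},F_{w,j}$ are positive operators on a (possibly infinite dimensional) Hilbert space $\mathcal H$ with $\sum_{i=1}^cE_{v,i}=\sum_{j=1}^cF_{w,j}=I$ and $E_{v,i}F_{w,j}=F_{w,j}E_{v,i}$ for all $v,w,i,j$, and $\xi\in\mathcal H$ is a unit vector. $\chi_{\mathrm{qc}}(G)$ is the least $c$ for which there is $p\in C_{\mathrm{qc}}(n,c)$ with $p(i,j|v,v)=0$ for all $v$, $i\ne j$, and $p(i,i|v,w)=0$ for all $(v,w)\in E$ and all $i$. *)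

theory Defs
  imports
    Complex_Main
    "HOL-Library.Extended_Real"
    "HOL-Library.Equipollence"
    "HOL-Library.Nonpos_Ints"
    "Graph_Theory.Pair_Digraph"
    "HOL-Algebra.Module"
begin

text \<open>
  Finite simple undirected graphs are \<^term>\<open>pair_graph\<close>s: a finite vertex set \<^term>\<open>pverts G\<close>
  with a finite, symmetric and irreflexive set \<^term>\<open>parcs G\<close> of ordered pairs of vertices, so that
  each edge occurs in both orientations.

  C*-algebras and Hilbert spaces are carrier-based, because the definitions below quantify
  existentially over all of them.  HOL cannot quantify over types inside a formula, so this
  quantifier ranges over all structures whose underlying set is a subset of a given type, the
  universe.  The universe is an arbitrary type of at least the cardinality of the continuum.
  Restricting to such a universe does not change the values: for the tracial rank one may replace
  the algebra by the C*-subalgebra generated by the finitely many projections and the unit, and for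
  the quantum correlations one may replace the Hilbert space by the closed subspace generated from
  the unit vector by the finitely many operators; both are separable.
\<close>

definition complex_ring :: "complex ring" where
  "complex_ring = \<lparr>carrier = UNIV, mult = (*), one = 1, zero = 0, add = (+)\<rparr>"

definition seq_complete_on :: "'a set \<Rightarrow> ('a \<Rightarrow> 'a \<Rightarrow> real) \<Rightarrow> bool" where
  "seq_complete_on S d \<longleftrightarrow>
     (\<forall>X :: nat \<Rightarrow> 'a. (\<forall>n. X n \<in> S) \<longrightarrow>
        (\<forall>\<epsilon>>0. \<exists>N. \<forall>m\<ge>N. \<forall>n\<ge>N. d (X m) (X n) < \<epsilon>) \<longrightarrow>
        (\<exists>x\<in>S. (\<lambda>n. d (X n) x) \<longlonglongrightarrow> 0))"


section \<open>Tracial rank\<close>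

record 'a cstar_alg = "(complex, 'a) module" +
  star :: "'a \<Rightarrow> 'a"
  cnorm :: "'a \<Rightarrow> real"

text \<open>
  The HOL-Algebra locale \<open>algebra\<close> requires a commutative multiplication and is therefore
  not used here.
\<close>

locale unital_cstar_algebra = module complex_ring A + ring A for A (structure) +
  assumes smult_mult_left:
      "\<lbrakk>x \<in> carrier A; y \<in> carrier A\<rbrakk> \<Longrightarrow> (c \<odot>\<^bsub>A\<^esub> x) \<otimes>\<^bsub>A\<^esub> y = c \<odot>\<^bsub>A\<^esub> (x \<otimes>\<^bsub>A\<^esub> y)"
    and smult_mult_right:
      "\<lbrakk>x \<in> carrier A; y \<in> carrier A\<rbrakk> \<Longrightarrow> x \<otimes>\<^bsub>A\<^esub> (c \<odot>\<^bsub>A\<^esub> y) = c \<odot>\<^bsub>A\<^esub> (x \<otimes>\<^bsub>A\<^esub> y)"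
    and star_closed: "x \<in> carrier A \<Longrightarrow> star A x \<in> carrier A"
    and star_star: "x \<in> carrier A \<Longrightarrow> star A (star A x) = x"
    and star_add:
      "\<lbrakk>x \<in> carrier A; y \<in> carrier A\<rbrakk> \<Longrightarrow> star A (x \<oplus>\<^bsub>A\<^esub> y) = star A x \<oplus>\<^bsub>A\<^esub> star A y"
    and star_smult: "x \<in> carrier A \<Longrightarrow> star A (c \<odot>\<^bsub>A\<^esub> x) = cnj c \<odot>\<^bsub>A\<^esub> star A x"
    and star_mult:
      "\<lbrakk>x \<in> carrier A; y \<in> carrier A\<rbrakk> \<Longrightarrow> star A (x \<otimes>\<^bsub>A\<^esub> y) = star A y \<otimes>\<^bsub>A\<^esub> star A x"
    and cnorm_nonneg: "x \<in> carrier A \<Longrightarrow> 0 \<le> cnorm A x"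
    and cnorm_eq_0: "x \<in> carrier A \<Longrightarrow> cnorm A x = 0 \<longleftrightarrow> x = \<zero>\<^bsub>A\<^esub>"
    and cnorm_add:
      "\<lbrakk>x \<in> carrier A; y \<in> carrier A\<rbrakk> \<Longrightarrow> cnorm A (x \<oplus>\<^bsub>A\<^esub> y) \<le> cnorm A x + cnorm A y"
    and cnorm_smult: "x \<in> carrier A \<Longrightarrow> cnorm A (c \<odot>\<^bsub>A\<^esub> x) = cmod c * cnorm A x"
    and cnorm_mult:
      "\<lbrakk>x \<in> carrier A; y \<in> carrier A\<rbrakk> \<Longrightarrow> cnorm A (x \<otimes>\<^bsub>A\<^esub> y) \<le> cnorm A x * cnorm A y"
    and cstar_identity: "x \<in> carrier A \<Longrightarrow> cnorm A (star A x \<otimes>\<^bsub>A\<^esub> x) = (cnorm A x)\<^sup>2"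
    and cnorm_complete: "seq_complete_on (carrier A) (\<lambda>x y. cnorm A (x \<ominus>\<^bsub>A\<^esub> y))"

definition cstar_state :: "'a cstar_alg \<Rightarrow> ('a \<Rightarrow> complex) \<Rightarrow> bool" where
  "cstar_state A s \<longleftrightarrow>
     (\<forall>x\<in>carrier A. \<forall>y\<in>carrier A. s (x \<oplus>\<^bsub>A\<^esub> y) = s x + s y) \<and>
     (\<forall>c. \<forall>x\<in>carrier A. s (c \<odot>\<^bsub>A\<^esub> x) = c * s x) \<and>
     (\<forall>x\<in>carrier A. s (star A x \<otimes>\<^bsub>A\<^esub> x) \<in> \<real>\<^sub>\<ge>\<^sub>0) \<and>
     s \<one>\<^bsub>A\<^esub> = 1"

definition tracial_state :: "'a cstar_alg \<Rightarrow> ('a \<Rightarrow> complex) \<Rightarrow> bool" where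
  "tracial_state A s \<longleftrightarrow>
     cstar_state A s \<and>
     (\<forall>x\<in>carrier A. \<forall>y\<in>carrier A. s (x \<otimes>\<^bsub>A\<^esub> y) = s (y \<otimes>\<^bsub>A\<^esub> x))"

definition cstar_projection :: "'a cstar_alg \<Rightarrow> 'a \<Rightarrow> bool" where
  "cstar_projection A e \<longleftrightarrow> e \<in> carrier A \<and> star A e = e \<and> e \<otimes>\<^bsub>A\<^esub> e = e"

definition tracial_values :: "'a itself \<Rightarrow> 'v pair_pre_digraph \<Rightarrow> real set" where
  "tracial_values _ G =
     {u. \<exists>(A :: 'a cstar_alg) s e.
           unital_cstar_algebra A \<and> tracial_state A s \<and>
           (\<forall>v\<in>pverts G. cstar_projection A (e v)) \<and>
           (\<forall>(v, w)\<in>parcs G. e v \<otimes>\<^bsub>A\<^esub> e w = \<zero>\<^bsub>A\<^esub>) \<and>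
           (\<forall>v\<in>pverts G. s (e v) = complex_of_real u)}"

text \<open>
  The supremum is taken in the extended reals: for the graph without vertices
  \<^const>\<open>tracial_values\<close> is unbounded, and its tracial rank is then \<open>1/\<infinity> = 0\<close>.
\<close>

definition xi_tr :: "'a itself \<Rightarrow> 'v pair_pre_digraph \<Rightarrow> ereal" where
  "xi_tr U G = 1 / (SUP u\<in>tracial_values U G. ereal u)"


section \<open>Commuting quantum chromatic number\<close>

text \<open>
  The fields \<open>mult\<close> and \<open>one\<close> inherited from HOL-Algebra modules play no role for Hilbert spaces.
  The inner product is linear in its first argument.
\<close>

record 'h hilbert = "(complex, 'h) module" +
  ip :: "'h \<Rightarrow> 'h \<Rightarrow> complex"

definition hnorm :: "'h hilbert \<Rightarrow> 'h \<Rightarrow> real" where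
  "hnorm H x = sqrt (Re (ip H x x))"

locale hilbert_space = module complex_ring H for H (structure) +
  assumes ip_add_left:
      "\<lbrakk>x \<in> carrier H; y \<in> carrier H; z \<in> carrier H\<rbrakk> \<Longrightarrow>
         ip H (x \<oplus>\<^bsub>H\<^esub> y) z = ip H x z + ip H y z"
    and ip_smult_left:
      "\<lbrakk>x \<in> carrier H; y \<in> carrier H\<rbrakk> \<Longrightarrow> ip H (c \<odot>\<^bsub>H\<^esub> x) y = c * ip H x y"
    and ip_commute: "\<lbrakk>x \<in> carrier H; y \<in> carrier H\<rbrakk> \<Longrightarrow> ip H y x = cnj (ip H x y)"
    and ip_nonneg: "x \<in> carrier H \<Longrightarrow> ip H x x \<in> \<real>\<^sub>\<ge>\<^sub>0"
    and ip_eq_0: "\<lbrakk>x \<in> carrier H; ip H x x = 0\<rbrakk> \<Longrightarrow> x = \<zero>\<^bsub>H\<^esub>"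
    and hnorm_complete: "seq_complete_on (carrier H) (\<lambda>x y. hnorm H (x \<ominus>\<^bsub>H\<^esub> y))"

text \<open>Only the values of an operator on the carrier are relevant.\<close>

definition bounded_operator :: "'h hilbert \<Rightarrow> ('h \<Rightarrow> 'h) \<Rightarrow> bool" where
  "bounded_operator H T \<longleftrightarrow>
     T \<in> carrier H \<rightarrow> carrier H \<and>
     (\<forall>x\<in>carrier H. \<forall>y\<in>carrier H. T (x \<oplus>\<^bsub>H\<^esub> y) = T x \<oplus>\<^bsub>H\<^esub> T y) \<and>
     (\<forall>c. \<forall>x\<in>carrier H. T (c \<odot>\<^bsub>H\<^esub> x) = c \<odot>\<^bsub>H\<^esub> T x) \<and>
     (\<exists>K. \<forall>x\<in>carrier H. hnorm H (T x) \<le> K * hnorm H x)"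

definition positive_operator :: "'h hilbert \<Rightarrow> ('h \<Rightarrow> 'h) \<Rightarrow> bool" where
  "positive_operator H T \<longleftrightarrow>
     bounded_operator H T \<and> (\<forall>x\<in>carrier H. ip H (T x) x \<in> \<real>\<^sub>\<ge>\<^sub>0)"

text \<open>
  The matrices are indexed by the vertex set itself rather than by an enumeration of it;
  \<open>p i j v w\<close> stands for \<open>p(i,j|v,w)\<close>.  Entries outside the index range are unconstrained.
\<close>

definition C_qc :: "'h itself \<Rightarrow> 'v set \<Rightarrow> nat \<Rightarrow> (nat \<Rightarrow> nat \<Rightarrow> 'v \<Rightarrow> 'v \<Rightarrow> real) set" where
  "C_qc _ V c =
     {p. \<exists>(H :: 'h hilbert) (E :: 'v \<Rightarrow> nat \<Rightarrow> 'h \<Rightarrow> 'h) (F :: 'v \<Rightarrow> nat \<Rightarrow> 'h \<Rightarrow> 'h) \<xi>.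
           hilbert_space H \<and>
           (\<forall>v\<in>V. \<forall>i\<in>{1..c}. positive_operator H (E v i) \<and> positive_operator H (F v i)) \<and>
           (\<forall>v\<in>V. \<forall>x\<in>carrier H. (\<Oplus>\<^bsub>H\<^esub>i\<in>{1..c}. E v i x) = x) \<and>
           (\<forall>w\<in>V. \<forall>x\<in>carrier H. (\<Oplus>\<^bsub>H\<^esub>j\<in>{1..c}. F w j x) = x) \<and>
           (\<forall>v\<in>V. \<forall>w\<in>V. \<forall>i\<in>{1..c}. \<forall>j\<in>{1..c}. \<forall>x\<in>carrier H.
              E v i (F w j x) = F w j (E v i x)) \<and>
           \<xi> \<in> carrier H \<and> hnorm H \<xi> = 1 \<and>
           (\<forall>v\<in>V. \<forall>w\<in>V. \<forall>i\<in>{1..c}. \<forall>j\<in>{1..c}.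
              complex_of_real (p i j v w) = ip H (E v i (F w j \<xi>)) \<xi>)}"

definition qc_colourable :: "'h itself \<Rightarrow> 'v pair_pre_digraph \<Rightarrow> nat \<Rightarrow> bool" where
  "qc_colourable U G c \<longleftrightarrow>
     (\<exists>p\<in>C_qc U (pverts G) c.
        (\<forall>v\<in>pverts G. \<forall>i\<in>{1..c}. \<forall>j\<in>{1..c}. i \<noteq> j \<longrightarrow> p i j v v = 0) \<and>
        (\<forall>(v, w)\<in>parcs G. \<forall>i\<in>{1..c}. p i i v w = 0))"

definition chi_qc :: "'h itself \<Rightarrow> 'v pair_pre_digraph \<Rightarrow> nat" where
  "chi_qc U G = (LEAST c. qc_colourable U G c)"

end

theory Submission
  imports Defs "HOL-Analysis.Abstract_Topology_2"
begin

text \<open>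
  Let \<open>E\<close>, \<open>F\<close>, \<open>\<xi>\<close> realise a commuting correlation that colours \<open>G\<close> with \<open>c\<close> colours.  The condition
  \<open>p(i,j|v,v) = 0\<close> for \<open>i \<noteq> j\<close> forces \<open>E\<^sub>v\<^sub>,\<^sub>i \<xi> = F\<^sub>v\<^sub>,\<^sub>i \<xi>\<close> and \<open>E\<^sub>v\<^sub>,\<^sub>i\<^sup>2 \<xi> = E\<^sub>v\<^sub>,\<^sub>i \<xi>\<close> (lemma \<open>synchronous\<close>), and the
  edge condition then gives \<open>E\<^sub>v\<^sub>,\<^sub>i E\<^sub>w\<^sub>,\<^sub>i \<xi> = 0\<close> for adjacent \<open>v\<close>, \<open>w\<close>.  Let \<open>K\<close> be the closed subspace
  generated by the operators \<open>E\<close> from \<open>\<xi>\<close>, and let \<open>M\<close> be the algebra of the bounded adjointable operators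
  on \<open>K\<close> that commute with all \<open>F\<^sub>v\<^sub>,\<^sub>i\<close>; it contains the operators \<open>E\<^sub>v\<^sub>,\<^sub>i\<close>.

  An element of \<open>M\<close> that kills \<open>\<xi>\<close> vanishes on \<open>K\<close>: acting with \<open>E\<^sub>a\<close> on \<open>\<xi>\<close> is the same as acting with
  \<open>F\<^sub>a\<close>, and \<open>F\<^sub>a\<close> can be pulled out to the left (lemma \<open>separating\<close>).  Hence the relations at \<open>\<xi>\<close> hold
  everywhere on \<open>K\<close>: the \<open>E\<^sub>v\<^sub>,\<^sub>i\<close> are projections there, orthogonal for adjacent vertices and equal colours.
  The same exchange of \<open>E\<^sub>a\<close> with \<open>F\<^sub>a\<close> shows that \<open>\<tau>(T) = \<langle>T\<xi>, \<xi>\<rangle>\<close> is a trace on \<open>M\<close> (lemmas \<open>poly_swap\<close>,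
  \<open>norm_le_adjoint\<close> and \<open>trace\<close>).  The values \<open>\<tau>(E\<^sub>v\<^sub>,\<^sub>i)\<close> depend on \<open>v\<close> and \<open>i\<close>, but for each \<open>v\<close> they
  add up to \<open>1\<close>.  In the \<open>c\<close>-fold direct sum of \<open>M\<close>, with the average of the traces of the components, the
  projection \<open>e\<^sub>v = (E\<^sub>v\<^sub>,\<^sub>1, \<dots>, E\<^sub>v\<^sub>,\<^sub>c)\<close> therefore has trace \<open>1/c\<close> for every \<open>v\<close>, so that the tracial rank
  is at most \<open>c\<close>.

  Two points concern the universes.  The direct sum has to be found on a subset of the type \<open>'a\<close>.  Since
  \<open>T \<mapsto> T\<xi>\<close> is injective on \<open>M\<close> and a vector of \<open>K\<close> is determined by its inner products with the countably many
  words in the \<open>E\<^sub>a\<close> applied to \<open>\<xi>\<close>, the algebra has at most the cardinality of the continuum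
  (\<open>carrier_lepoll_reals\<close>), and it can be transported along an injection (\<open>tracial_values_transportI\<close>).
  Secondly, the least number of colours is attained only if some colouring exists; an injective
  classical colouring on a one-dimensional Hilbert space is one (\<open>qc_colourable_exists\<close>).
\<close>

section \<open>Hilbert spaces\<close>

lemma complex_ring_simps [simp]:
  "carrier complex_ring = UNIV" "c \<otimes>\<^bsub>complex_ring\<^esub> d = c * d" "\<one>\<^bsub>complex_ring\<^esub> = 1"
  "\<zero>\<^bsub>complex_ring\<^esub> = 0" "c \<oplus>\<^bsub>complex_ring\<^esub> d = c + d"
  by (simp_all add: complex_ring_def)

lemma cring_complex_ring: "cring complex_ring"
proof (rule cringI)
  show "abelian_group complex_ring"
  proof (rule abelian_groupI)
    show "\<exists>y\<in>carrier complex_ring. y \<oplus>\<^bsub>complex_ring\<^esub> x = \<zero>\<^bsub>complex_ring\<^esub>" for x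
      by (intro bexI[of _ "- x"]) auto
  qed (auto simp: algebra_simps)
  show "comm_monoid complex_ring"
    by unfold_locales (auto simp: algebra_simps)
qed (auto simp: algebra_simps)

lemma nonneg_Reals_complex_iff: "z \<in> \<real>\<^sub>\<ge>\<^sub>0 \<longleftrightarrow> 0 \<le> Re z \<and> Im z = 0" for z :: complex
proof
  assume "0 \<le> Re z \<and> Im z = 0"
  then have "z = of_real (Re z)" "Re z \<ge> 0" by (auto simp: complex_eq_iff)
  then show "z \<in> \<real>\<^sub>\<ge>\<^sub>0" by (metis nonneg_Reals_of_real_iff)
qed (auto elim!: nonneg_Reals_cases)

context hilbert_space
begin

lemma ip_smult_right:
  assumes "x \<in> carrier H" "y \<in> carrier H"
  shows "ip H x (c \<odot>\<^bsub>H\<^esub> y) = cnj c * ip H x y"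
proof -
  have "ip H x (c \<odot>\<^bsub>H\<^esub> y) = cnj (ip H (c \<odot>\<^bsub>H\<^esub> y) x)"
    by (rule ip_commute) (use assms in auto)
  then show ?thesis using assms ip_commute[of x y] by (simp add: ip_smult_left)
qed

lemma ip_add_right:
  assumes "x \<in> carrier H" "y \<in> carrier H" "z \<in> carrier H"
  shows "ip H x (y \<oplus>\<^bsub>H\<^esub> z) = ip H x y + ip H x z"
proof -
  have "ip H x (y \<oplus>\<^bsub>H\<^esub> z) = cnj (ip H (y \<oplus>\<^bsub>H\<^esub> z) x)"
    by (rule ip_commute) (use assms in auto)
  then show ?thesis using assms ip_commute[of x y] ip_commute[of x z] by (simp add: ip_add_left)
qed

lemma ip_zero_left [simp]: "x \<in> carrier H \<Longrightarrow> ip H \<zero>\<^bsub>H\<^esub> x = 0"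
  using ip_add_left[of "\<zero>\<^bsub>H\<^esub>" "\<zero>\<^bsub>H\<^esub>" x] by simp

lemma ip_zero_right [simp]: "x \<in> carrier H \<Longrightarrow> ip H x \<zero>\<^bsub>H\<^esub> = 0"
  using ip_add_right[of x "\<zero>\<^bsub>H\<^esub>" "\<zero>\<^bsub>H\<^esub>"] by simp

lemma ip_uminus_left: "x \<in> carrier H \<Longrightarrow> y \<in> carrier H \<Longrightarrow> ip H (\<ominus>\<^bsub>H\<^esub> x) y = - ip H x y"
  using ip_add_left[of "\<ominus>\<^bsub>H\<^esub> x" x y] by (simp add: M.l_neg eq_neg_iff_add_eq_0)

lemma ip_uminus_right: "x \<in> carrier H \<Longrightarrow> y \<in> carrier H \<Longrightarrow> ip H x (\<ominus>\<^bsub>H\<^esub> y) = - ip H x y"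
  using ip_add_right[of x "\<ominus>\<^bsub>H\<^esub> y" y] by (simp add: M.l_neg eq_neg_iff_add_eq_0)

lemma ip_minus_left:
  "\<lbrakk>x \<in> carrier H; y \<in> carrier H; z \<in> carrier H\<rbrakk> \<Longrightarrow> ip H (x \<ominus>\<^bsub>H\<^esub> y) z = ip H x z - ip H y z"
  by (simp add: a_minus_def ip_add_left ip_uminus_left)

lemma ip_minus_right:
  "\<lbrakk>x \<in> carrier H; y \<in> carrier H; z \<in> carrier H\<rbrakk> \<Longrightarrow> ip H x (y \<ominus>\<^bsub>H\<^esub> z) = ip H x y - ip H x z"
  by (simp add: a_minus_def ip_add_right ip_uminus_right)

lemmas ip_simps = ip_add_left ip_add_right ip_smult_left ip_smult_right ip_minus_left ip_minus_right
  ip_uminus_left ip_uminus_right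

lemma hnorm_nonneg [simp]: "x \<in> carrier H \<Longrightarrow> 0 \<le> hnorm H x"
  using ip_nonneg by (auto simp: hnorm_def nonneg_Reals_complex_iff)

lemma ip_self: "x \<in> carrier H \<Longrightarrow> ip H x x = complex_of_real ((hnorm H x)\<^sup>2)"
  using ip_nonneg[of x] by (auto simp: hnorm_def nonneg_Reals_complex_iff complex_eq_iff)

lemma hnorm_sq: "x \<in> carrier H \<Longrightarrow> (hnorm H x)\<^sup>2 = Re (ip H x x)"
  by (simp add: ip_self)

lemma hnorm_zero [simp]: "hnorm H \<zero>\<^bsub>H\<^esub> = 0"
  by (simp add: hnorm_def)

lemma hnorm_eq_0_iff [simp]: "x \<in> carrier H \<Longrightarrow> hnorm H x = 0 \<longleftrightarrow> x = \<zero>\<^bsub>H\<^esub>"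
  using ip_eq_0 ip_self by force

lemma minus_eq_0_iff: "\<lbrakk>x \<in> carrier H; y \<in> carrier H\<rbrakk> \<Longrightarrow> x \<ominus>\<^bsub>H\<^esub> y = \<zero>\<^bsub>H\<^esub> \<longleftrightarrow> x = y"
  by (metis M.minus_equality M.minus_minus M.r_neg a_minus_def M.a_inv_closed)

text \<open>Vector identities are tested against inner products below, which turns module arithmetic
  into arithmetic with complex numbers.\<close>

lemma eqI_ip:
  assumes "x \<in> carrier H" "y \<in> carrier H" "\<And>z. z \<in> carrier H \<Longrightarrow> ip H x z = ip H y z"
  shows "x = y"
proof -
  have "ip H (x \<ominus>\<^bsub>H\<^esub> y) (x \<ominus>\<^bsub>H\<^esub> y) = 0"
    using assms by (simp add: ip_minus_left)
  then have "x \<ominus>\<^bsub>H\<^esub> y = \<zero>\<^bsub>H\<^esub>" using assms by (intro ip_eq_0) auto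
  then show ?thesis using assms minus_eq_0_iff by blast
qed

lemma hnorm_smult: "x \<in> carrier H \<Longrightarrow> hnorm H (c \<odot>\<^bsub>H\<^esub> x) = cmod c * hnorm H x"
proof -
  assume x: "x \<in> carrier H"
  have "ip H (c \<odot>\<^bsub>H\<^esub> x) (c \<odot>\<^bsub>H\<^esub> x) = (c * cnj c) * ip H x x"
    using x by (simp add: ip_simps)
  then have "(hnorm H (c \<odot>\<^bsub>H\<^esub> x))\<^sup>2 = (cmod c * hnorm H x)\<^sup>2"
    using x by (simp add: hnorm_sq power_mult_distrib flip: complex_norm_square of_real_power)
  then show ?thesis using x by (simp add: power2_eq_iff_nonneg)
qed

lemma hnorm_minus_commute:
  "\<lbrakk>x \<in> carrier H; y \<in> carrier H\<rbrakk> \<Longrightarrow> hnorm H (x \<ominus>\<^bsub>H\<^esub> y) = hnorm H (y \<ominus>\<^bsub>H\<^esub> x)"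
  by (simp add: hnorm_def ip_simps)

lemma cauchy_schwarz:
  assumes x: "x \<in> carrier H" and y: "y \<in> carrier H"
  shows "cmod (ip H x y) \<le> hnorm H x * hnorm H y"
proof (cases "y = \<zero>\<^bsub>H\<^esub>")
  case False
  define n where "n = (hnorm H y)\<^sup>2"
  have n: "n > 0" using False y by (simp add: n_def)
  \<comment> \<open>Up to the factor \<open>n\<close>, the component of \<open>x\<close> orthogonal to \<open>y\<close>; clearing the denominator avoids
    division in the module.\<close>
  define z where "z = (of_real n \<odot>\<^bsub>H\<^esub> x) \<ominus>\<^bsub>H\<^esub> (ip H x y \<odot>\<^bsub>H\<^esub> y)"
  have yx: "ip H y x = cnj (ip H x y)" by (rule ip_commute[OF x y])
  have yy: "ip H y y = of_real n" by (simp add: ip_self y n_def)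
  have "ip H z z = of_real n * (of_real n * ip H x x - ip H x y * cnj (ip H x y))"
    unfolding z_def using x y by (simp add: ip_simps yy yx algebra_simps)
  then have zz: "Re (ip H z z) = n * (n * (hnorm H x)\<^sup>2 - (cmod (ip H x y))\<^sup>2)"
    by (simp add: ip_self[OF x] flip: complex_norm_square)
  have "0 \<le> Re (ip H z z)"
    using x y by (simp add: z_def ip_self)
  then have "0 \<le> n * (hnorm H x)\<^sup>2 - (cmod (ip H x y))\<^sup>2"
    unfolding zz using n by (simp add: zero_le_mult_iff)
  then have "(cmod (ip H x y))\<^sup>2 \<le> (hnorm H x * hnorm H y)\<^sup>2"
    by (simp add: n_def power_mult_distrib mult.commute)
  then show ?thesis using x y by (simp add: power2_le_iff_abs_le)
qed (use x in simp)

lemma hnorm_add: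
  assumes x: "x \<in> carrier H" and y: "y \<in> carrier H"
  shows "hnorm H (x \<oplus>\<^bsub>H\<^esub> y) \<le> hnorm H x + hnorm H y"
proof -
  have "ip H (x \<oplus>\<^bsub>H\<^esub> y) (x \<oplus>\<^bsub>H\<^esub> y) = ip H x x + ip H y y + (ip H x y + cnj (ip H x y))"
    using x y ip_commute[OF x y] by (simp add: ip_simps)
  then have "(hnorm H (x \<oplus>\<^bsub>H\<^esub> y))\<^sup>2 = (hnorm H x)\<^sup>2 + (hnorm H y)\<^sup>2 + 2 * Re (ip H x y)"
    using x y by (simp add: hnorm_sq)
  also have "\<dots> \<le> (hnorm H x + hnorm H y)\<^sup>2"
    using cauchy_schwarz[OF x y] complex_Re_le_cmod[of "ip H x y"] by (simp add: power2_sum)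
  finally show ?thesis using x y by (meson add_nonneg_nonneg hnorm_nonneg power2_le_imp_le)
qed

lemma hnorm_triangle:
  assumes "x \<in> carrier H" "y \<in> carrier H" "z \<in> carrier H"
  shows "hnorm H (x \<ominus>\<^bsub>H\<^esub> z) \<le> hnorm H (x \<ominus>\<^bsub>H\<^esub> y) + hnorm H (y \<ominus>\<^bsub>H\<^esub> z)"
proof -
  have "x \<ominus>\<^bsub>H\<^esub> z = (x \<ominus>\<^bsub>H\<^esub> y) \<oplus>\<^bsub>H\<^esub> (y \<ominus>\<^bsub>H\<^esub> z)"
    by (rule eqI_ip) (use assms in \<open>auto simp: ip_simps\<close>)
  then show ?thesis using hnorm_add[of "x \<ominus>\<^bsub>H\<^esub> y" "y \<ominus>\<^bsub>H\<^esub> z"] assms by simp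
qed

lemma ip_finsum_left:
  assumes "finite I" "\<And>i. i \<in> I \<Longrightarrow> f i \<in> carrier H" "y \<in> carrier H"
  shows "ip H (\<Oplus>\<^bsub>H\<^esub>i\<in>I. f i) y = (\<Sum>i\<in>I. ip H (f i) y)"
  using assms by (induction I rule: finite_induct) (auto simp: M.finsum_insert ip_add_left Pi_iff)

end

section \<open>The C*-algebra of operator families commuting with given operators\<close>

definition adjoint_ops :: "'h hilbert \<Rightarrow> ('h \<Rightarrow> 'h) \<Rightarrow> ('h \<Rightarrow> 'h) \<Rightarrow> bool" where
  "adjoint_ops H T S \<longleftrightarrow> T \<in> carrier H \<rightarrow> carrier H \<and> S \<in> carrier H \<rightarrow> carrier H \<and>
     (\<forall>x\<in>carrier H. \<forall>y\<in>carrier H. ip H (T x) y = ip H x (S y))"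

text \<open>Adjoints are unique on the carrier, so the choice matters only outside, where the restriction
  makes it irrelevant.\<close>

definition op_adj :: "'h hilbert \<Rightarrow> ('h \<Rightarrow> 'h) \<Rightarrow> 'h \<Rightarrow> 'h" where
  "op_adj H T = restrict (SOME S. adjoint_ops H T S) (carrier H)"

definition bounded_by :: "'i set \<Rightarrow> 'h hilbert \<Rightarrow> ('i \<Rightarrow> 'h \<Rightarrow> 'h) \<Rightarrow> real \<Rightarrow> bool" where
  "bounded_by I H T B \<longleftrightarrow> (\<forall>i\<in>I. \<forall>x\<in>carrier H. hnorm H (T i x) \<le> B * hnorm H x)"

definition family_norm :: "'i set \<Rightarrow> 'h hilbert \<Rightarrow> ('i \<Rightarrow> 'h \<Rightarrow> 'h) \<Rightarrow> real" where
  "family_norm I H T = Inf {B. 0 \<le> B \<and> bounded_by I H T B}"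

text \<open>Families indexed by \<open>I\<close> encode the direct sum of copies of the commutant of \<open>F\<close>.  They are
  extensional in both arguments, so that pointwise equality on \<open>I\<close> and on the Hilbert space is equality.
  Adjoints are part of the definition, which makes the involution available without the Riesz
  representation theorem.\<close>

definition commutant_carrier ::
    "'i set \<Rightarrow> 'h hilbert \<Rightarrow> ('h \<Rightarrow> 'h) set \<Rightarrow> ('i \<Rightarrow> 'h \<Rightarrow> 'h) set" where
  "commutant_carrier I H F =
     {T \<in> I \<rightarrow>\<^sub>E (carrier H \<rightarrow>\<^sub>E carrier H).
        (\<forall>i\<in>I. \<exists>S. adjoint_ops H (T i) S) \<and> (\<exists>B. bounded_by I H T B) \<and>
        (\<forall>i\<in>I. \<forall>f\<in>F. \<forall>x\<in>carrier H. T i (f x) = f (T i x))}"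

definition commutant_alg ::
    "'i set \<Rightarrow> 'h hilbert \<Rightarrow> ('h \<Rightarrow> 'h) set \<Rightarrow> ('i \<Rightarrow> 'h \<Rightarrow> 'h) cstar_alg" where
  "commutant_alg I H F =
     \<lparr>carrier = commutant_carrier I H F,
      mult = (\<lambda>T S. \<lambda>i\<in>I. \<lambda>x\<in>carrier H. T i (S i x)),
      one = (\<lambda>i\<in>I. \<lambda>x\<in>carrier H. x),
      zero = (\<lambda>i\<in>I. \<lambda>x\<in>carrier H. \<zero>\<^bsub>H\<^esub>),
      add = (\<lambda>T S. \<lambda>i\<in>I. \<lambda>x\<in>carrier H. T i x \<oplus>\<^bsub>H\<^esub> S i x),
      smult = (\<lambda>c T. \<lambda>i\<in>I. \<lambda>x\<in>carrier H. c \<odot>\<^bsub>H\<^esub> T i x),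
      star = (\<lambda>T. \<lambda>i\<in>I. op_adj H (T i)),
      cnorm = family_norm I H\<rparr>"

context hilbert_space
begin

lemma complex_smult:
  assumes "x \<in> carrier H"
  shows "(a + b) \<odot>\<^bsub>H\<^esub> x = a \<odot>\<^bsub>H\<^esub> x \<oplus>\<^bsub>H\<^esub> b \<odot>\<^bsub>H\<^esub> x" "(a * b) \<odot>\<^bsub>H\<^esub> x = a \<odot>\<^bsub>H\<^esub> (b \<odot>\<^bsub>H\<^esub> x)"
    "1 \<odot>\<^bsub>H\<^esub> x = x"
  using assms smult_l_distr[of a b x] smult_assoc1[of a b x] smult_one[of x] by simp_all

lemma adjoint_opsI:
  "\<lbrakk>\<And>x. x \<in> carrier H \<Longrightarrow> T x \<in> carrier H; \<And>x. x \<in> carrier H \<Longrightarrow> S x \<in> carrier H;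
    \<And>x y. \<lbrakk>x \<in> carrier H; y \<in> carrier H\<rbrakk> \<Longrightarrow> ip H (T x) y = ip H x (S y)\<rbrakk> \<Longrightarrow> adjoint_ops H T S"
  by (auto simp: adjoint_ops_def)

lemma adjoint_opsD:
  assumes "adjoint_ops H T S"
  shows "x \<in> carrier H \<Longrightarrow> T x \<in> carrier H" "x \<in> carrier H \<Longrightarrow> S x \<in> carrier H"
    "\<lbrakk>x \<in> carrier H; y \<in> carrier H\<rbrakk> \<Longrightarrow> ip H (T x) y = ip H x (S y)"
  using assms by (auto simp: adjoint_ops_def)

lemma adjoint_ops_sym:
  assumes "adjoint_ops H T S" shows "adjoint_ops H S T"
proof (rule adjoint_opsI)
  fix x y assume "x \<in> carrier H" "y \<in> carrier H"
  then show "ip H (S x) y = ip H x (T y)"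
    using adjoint_opsD[OF assms] ip_commute[of "S x" y] ip_commute[of "T y" x] by auto
qed (use adjoint_opsD[OF assms] in auto)

text \<open>Linearity comes from the other side: in an inner product with any fixed vector, \<open>T\<close> can be replaced
  by the action of \<open>S\<close> on that vector.\<close>

lemma adjoint_ops_linear:
  assumes "adjoint_ops H T S"
  shows "\<lbrakk>x \<in> carrier H; y \<in> carrier H\<rbrakk> \<Longrightarrow> T (x \<oplus>\<^bsub>H\<^esub> y) = T x \<oplus>\<^bsub>H\<^esub> T y"
    and "x \<in> carrier H \<Longrightarrow> T (c \<odot>\<^bsub>H\<^esub> x) = c \<odot>\<^bsub>H\<^esub> T x"
    and "T \<zero>\<^bsub>H\<^esub> = \<zero>\<^bsub>H\<^esub>"
    and "\<lbrakk>x \<in> carrier H; y \<in> carrier H\<rbrakk> \<Longrightarrow> T (x \<ominus>\<^bsub>H\<^esub> y) = T x \<ominus>\<^bsub>H\<^esub> T y"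
  by (rule eqI_ip; use adjoint_opsD[OF assms] in \<open>simp add: ip_simps\<close>)+

lemma adjoint_ops_op_adj:
  assumes "adjoint_ops H T S" shows "adjoint_ops H T (op_adj H T)"
proof -
  have "adjoint_ops H T (SOME S. adjoint_ops H T S)"
    by (rule someI[of "\<lambda>S. adjoint_ops H T S", OF assms])
  then show ?thesis by (auto simp: adjoint_ops_def op_adj_def)
qed

text \<open>\<open>\<parallel>S x\<parallel>\<^sup>2 = \<langle>T (S x), x\<rangle> \<le> B \<parallel>S x\<parallel> \<parallel>x\<parallel>\<close>, and one factor \<open>\<parallel>S x\<parallel>\<close> cancels.\<close>

lemma adjoint_bounded:
  assumes adj: "adjoint_ops H T S" and B: "\<And>x. x \<in> carrier H \<Longrightarrow> hnorm H (T x) \<le> B * hnorm H x"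
    and x: "x \<in> carrier H"
  shows "hnorm H (S x) \<le> B * hnorm H x"
proof (cases "hnorm H (S x) = 0")
  case True
  have "0 \<le> hnorm H (T x)" using adjoint_opsD(1)[OF adj x] by simp
  with B[OF x] True show ?thesis by simp
next
  case False
  have Sx: "S x \<in> carrier H" using adjoint_opsD[OF adj] x by simp
  have "hnorm H (S x) * hnorm H (S x) = Re (ip H (T (S x)) x)"
    using adjoint_opsD[OF adj] x Sx by (simp add: ip_self power2_eq_square)
  also have "\<dots> \<le> hnorm H (T (S x)) * hnorm H x"
    using cauchy_schwarz[of "T (S x)" x] complex_Re_le_cmod[of "ip H (T (S x)) x"]
      adjoint_opsD(1)[OF adj Sx] x by simp
  also have "\<dots> \<le> B * hnorm H (S x) * hnorm H x"
    by (rule mult_right_mono) (use B Sx x in auto)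
  finally have "hnorm H (S x) * hnorm H (S x) \<le> (B * hnorm H x) * hnorm H (S x)"
    by (simp add: mult_ac)
  with False Sx show ?thesis by (simp add: mult_le_cancel_right order.strict_iff_order)
qed

text \<open>The set of admissible bounds is a closed half-line, and \<^const>\<open>family_norm\<close> is its end point.
  All norm axioms are read off from this.\<close>

lemma family_norm_bound:
  assumes "bounded_by I H T B"
  shows "0 \<le> family_norm I H T" "bounded_by I H T (family_norm I H T)"
    and "0 \<le> C \<Longrightarrow> bounded_by I H T C \<Longrightarrow> family_norm I H T \<le> C"
proof -
  let ?X = "{B. 0 \<le> B \<and> bounded_by I H T B}"
  have "bounded_by I H T (max 0 B)"
    unfolding bounded_by_def
  proof (intro ballI)
    fix i x assume *: "i \<in> I" "x \<in> carrier H"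
    have "hnorm H (T i x) \<le> B * hnorm H x" using assms * by (auto simp: bounded_by_def)
    also have "\<dots> \<le> max 0 B * hnorm H x" using * by (intro mult_right_mono) auto
    finally show "hnorm H (T i x) \<le> max 0 B * hnorm H x" .
  qed
  then have ne: "?X \<noteq> {}" using max.cobounded1 by blast
  have bdd: "bdd_below ?X" by (auto intro: bdd_belowI[of _ 0])
  show nn: "0 \<le> family_norm I H T"
    unfolding family_norm_def by (rule cInf_greatest[OF ne]) auto
  show "0 \<le> C \<Longrightarrow> bounded_by I H T C \<Longrightarrow> family_norm I H T \<le> C"
    unfolding family_norm_def by (rule cInf_lower[OF _ bdd]) auto
  show "bounded_by I H T (family_norm I H T)"
    unfolding bounded_by_def
  proof (intro ballI)
    fix i x assume ix: "i \<in> I" "x \<in> carrier H"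
    show "hnorm H (T i x) \<le> family_norm I H T * hnorm H x"
    proof (cases "hnorm H x = 0")
      case True
      obtain b where "b \<in> ?X" using ne by blast
      then have "hnorm H (T i x) \<le> b * hnorm H x" using ix by (auto simp: bounded_by_def)
      with True show ?thesis by simp
    next
      case False
      then have pos: "hnorm H x > 0" using ix hnorm_nonneg[of x] by linarith
      have "hnorm H (T i x) / hnorm H x \<le> family_norm I H T"
        unfolding family_norm_def
        by (rule cInf_greatest[OF ne]) (use ix pos in \<open>auto simp: bounded_by_def divide_le_eq\<close>)
      then show ?thesis using pos by (simp add: divide_le_eq)
    qed
  qed
qed

end

locale operator_commutant = hilbert_space H for H (structure) +
  fixes I :: "'i set" and F :: "('a \<Rightarrow> 'a) set"
  assumes F_selfadjoint: "f \<in> F \<Longrightarrow> adjoint_ops H f f"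
begin

abbreviation (input) A where "A \<equiv> commutant_alg I H F"

lemma A_sel [simp]:
  "carrier A = commutant_carrier I H F"
  "cnorm A = family_norm I H"
  by (simp_all add: commutant_alg_def)

lemma A_apply [simp]:
  assumes "i \<in> I" "x \<in> carrier H"
  shows "(T \<otimes>\<^bsub>A\<^esub> S) i x = T i (S i x)" "\<one>\<^bsub>A\<^esub> i x = x" "\<zero>\<^bsub>A\<^esub> i x = \<zero>\<^bsub>H\<^esub>"
    "(T \<oplus>\<^bsub>A\<^esub> S) i x = T i x \<oplus>\<^bsub>H\<^esub> S i x" "(c \<odot>\<^bsub>A\<^esub> T) i x = c \<odot>\<^bsub>H\<^esub> T i x"
  using assms by (simp_all add: commutant_alg_def)

lemma star_apply: "i \<in> I \<Longrightarrow> star A T i = op_adj H (T i)"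
  by (simp add: commutant_alg_def)

lemma closed [simp, intro]:
  assumes "T \<in> commutant_carrier I H F" "i \<in> I" "x \<in> carrier H"
  shows "T i x \<in> carrier H"
  using assms by (auto simp: commutant_carrier_def PiE_iff)

lemma adj:
  assumes "T \<in> commutant_carrier I H F" "i \<in> I"
  shows "adjoint_ops H (T i) (op_adj H (T i))"
  using assms adjoint_ops_op_adj by (auto simp: commutant_carrier_def)

lemma comm:
  assumes "T \<in> commutant_carrier I H F" "i \<in> I" "f \<in> F" "x \<in> carrier H"
  shows "T i (f x) = f (T i x)"
  using assms by (auto simp: commutant_carrier_def)

lemma bound:
  assumes "T \<in> commutant_carrier I H F" "i \<in> I" "x \<in> carrier H"
  shows "hnorm H (T i x) \<le> family_norm I H T * hnorm H x"
proof -
  obtain B where "bounded_by I H T B" using assms by (auto simp: commutant_carrier_def)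
  from family_norm_bound(2)[OF this] show ?thesis using assms by (auto simp: bounded_by_def)
qed

lemma norm_nonneg: "T \<in> commutant_carrier I H F \<Longrightarrow> 0 \<le> family_norm I H T"
  using family_norm_bound(1) by (auto simp: commutant_carrier_def)

lemma norm_leI:
  assumes "0 \<le> B" "\<And>i x. \<lbrakk>i \<in> I; x \<in> carrier H\<rbrakk> \<Longrightarrow> hnorm H (T i x) \<le> B * hnorm H x"
  shows "family_norm I H T \<le> B"
  using assms family_norm_bound(3)[of I T B B] by (auto simp: bounded_by_def)

lemma memI:
  assumes "\<And>i. i \<in> I \<Longrightarrow> adjoint_ops H (T i) (S i)"
    and "\<And>i x. \<lbrakk>i \<in> I; x \<in> carrier H\<rbrakk> \<Longrightarrow> hnorm H (T i x) \<le> B * hnorm H x"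
    and "\<And>i f x. \<lbrakk>i \<in> I; f \<in> F; x \<in> carrier H\<rbrakk> \<Longrightarrow> T i (f x) = f (T i x)"
    and "T \<in> extensional I" "\<And>i. i \<in> I \<Longrightarrow> T i \<in> extensional (carrier H)"
  shows "T \<in> commutant_carrier I H F"
proof -
  have "T i x \<in> carrier H" if "i \<in> I" "x \<in> carrier H" for i x
    using adjoint_opsD(1)[OF assms(1)] that by blast
  then have "T \<in> I \<rightarrow>\<^sub>E (carrier H \<rightarrow>\<^sub>E carrier H)"
    using assms(4,5) by (auto simp: PiE_iff)
  moreover have "bounded_by I H T B" using assms(2) by (auto simp: bounded_by_def)
  ultimately show ?thesis using assms(1,3) by (auto simp: commutant_carrier_def)
qed

lemma mem_PiE: "T \<in> commutant_carrier I H F \<Longrightarrow> T \<in> I \<rightarrow>\<^sub>E (carrier H \<rightarrow>\<^sub>E carrier H)"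
  by (simp add: commutant_carrier_def)

lemma eqI:
  assumes "T \<in> commutant_carrier I H F" "S \<in> commutant_carrier I H F"
    and "\<And>i x. \<lbrakk>i \<in> I; x \<in> carrier H\<rbrakk> \<Longrightarrow> T i x = S i x"
  shows "T = S"
proof (rule extensionalityI[of T I])
  show "T \<in> extensional I" "S \<in> extensional I"
    using mem_PiE[OF assms(1)] mem_PiE[OF assms(2)] by (auto simp: PiE_iff)
  fix i assume i: "i \<in> I"
  show "T i = S i"
    by (rule extensionalityI[of _ "carrier H"])
       (use mem_PiE[OF assms(1)] mem_PiE[OF assms(2)] assms(3)[OF i] i in \<open>auto simp: PiE_iff\<close>)
qed

lemma F_closed [simp, intro]: "f \<in> F \<Longrightarrow> x \<in> carrier H \<Longrightarrow> f x \<in> carrier H"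
  using adjoint_opsD(1)[OF F_selfadjoint] by auto

lemma star_bound:
  assumes "T \<in> commutant_carrier I H F" "i \<in> I" "x \<in> carrier H"
  shows "hnorm H (op_adj H (T i) x) \<le> family_norm I H T * hnorm H x"
  using adjoint_bounded[OF adj[OF assms(1,2)]] bound assms by blast

text \<open>Commutation with \<open>F\<close> passes to the adjoint because the members of \<open>F\<close> are self-adjoint.\<close>

lemma star_mem:
  assumes T: "T \<in> commutant_carrier I H F"
  shows "star A T \<in> commutant_carrier I H F"
proof (rule memI[where S = T and B = "family_norm I H T"])
  fix i assume i: "i \<in> I"
  note ad = adj[OF T i]
  have star: "star A T i = op_adj H (T i)" using i by (simp add: commutant_alg_def)
  show "adjoint_ops H (star A T i) (T i)"
    unfolding star by (rule adjoint_ops_sym[OF ad])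
  show "hnorm H (star A T i x) \<le> family_norm I H T * hnorm H x" if "x \<in> carrier H" for x
    unfolding star using star_bound[OF T i that] .
  show "star A T i \<in> extensional (carrier H)"
    unfolding star by (simp add: op_adj_def)
  fix f x assume f: "f \<in> F" and x: "x \<in> carrier H"
  note D = adjoint_opsD[OF adjoint_ops_sym[OF ad]] and fD = adjoint_opsD[OF F_selfadjoint[OF f]]
  show "star A T i (f x) = f (star A T i x)"
    unfolding star
    by (rule eqI_ip) (use x f i D fD comm[OF T i f] in auto)
qed (simp add: commutant_alg_def)

lemma mult_mem:
  assumes T: "T \<in> commutant_carrier I H F" and S: "S \<in> commutant_carrier I H F"
  shows "T \<otimes>\<^bsub>A\<^esub> S \<in> commutant_carrier I H F"
    and "family_norm I H (T \<otimes>\<^bsub>A\<^esub> S) \<le> family_norm I H T * family_norm I H S"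
proof -
  have b: "hnorm H ((T \<otimes>\<^bsub>A\<^esub> S) i x) \<le> family_norm I H T * family_norm I H S * hnorm H x"
    if "i \<in> I" "x \<in> carrier H" for i x
  proof -
    have "hnorm H (T i (S i x)) \<le> family_norm I H T * hnorm H (S i x)"
      using T S that by (intro bound) auto
    also have "\<dots> \<le> family_norm I H T * (family_norm I H S * hnorm H x)"
      using T S that by (intro mult_left_mono bound norm_nonneg) auto
    finally show ?thesis using that by (simp add: mult_ac)
  qed
  then show "family_norm I H (T \<otimes>\<^bsub>A\<^esub> S) \<le> family_norm I H T * family_norm I H S"
    using T S by (intro norm_leI mult_nonneg_nonneg norm_nonneg) auto
  show "T \<otimes>\<^bsub>A\<^esub> S \<in> commutant_carrier I H F"
  proof (rule memI[OF _ b, where S = "\<lambda>i x. op_adj H (S i) (op_adj H (T i) x)"])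
    fix i assume i: "i \<in> I"
    show "adjoint_ops H ((T \<otimes>\<^bsub>A\<^esub> S) i) (\<lambda>x. op_adj H (S i) (op_adj H (T i) x))"
      by (rule adjoint_opsI) (use i T S adjoint_opsD[OF adj[OF T i]] adjoint_opsD[OF adj[OF S i]] in auto)
  qed (use T S in \<open>auto simp: comm\<close>, auto simp: commutant_alg_def extensional_def)
qed

lemma add_mem:
  assumes T: "T \<in> commutant_carrier I H F" and S: "S \<in> commutant_carrier I H F"
  shows "T \<oplus>\<^bsub>A\<^esub> S \<in> commutant_carrier I H F"
    and "family_norm I H (T \<oplus>\<^bsub>A\<^esub> S) \<le> family_norm I H T + family_norm I H S"
proof -
  have b: "hnorm H ((T \<oplus>\<^bsub>A\<^esub> S) i x) \<le> (family_norm I H T + family_norm I H S) * hnorm H x"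
    if "i \<in> I" "x \<in> carrier H" for i x
    using hnorm_add[of "T i x" "S i x"] bound[OF T that] bound[OF S that] T S that
    by (simp add: distrib_right)
  then show "family_norm I H (T \<oplus>\<^bsub>A\<^esub> S) \<le> family_norm I H T + family_norm I H S"
    using T S by (intro norm_leI add_nonneg_nonneg norm_nonneg) auto
  show "T \<oplus>\<^bsub>A\<^esub> S \<in> commutant_carrier I H F"
  proof (rule memI[OF _ b, where S = "\<lambda>i x. op_adj H (T i) x \<oplus>\<^bsub>H\<^esub> op_adj H (S i) x"])
    fix i assume i: "i \<in> I"
    show "adjoint_ops H ((T \<oplus>\<^bsub>A\<^esub> S) i) (\<lambda>x. op_adj H (T i) x \<oplus>\<^bsub>H\<^esub> op_adj H (S i) x)"
      by (rule adjoint_opsI) (use i T S adjoint_opsD[OF adj[OF T i]] adjoint_opsD[OF adj[OF S i]]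
          in \<open>auto simp: ip_simps\<close>)
  next
    fix i f x assume "i \<in> I" "f \<in> F" "x \<in> carrier H"
    then show "(T \<oplus>\<^bsub>A\<^esub> S) i (f x) = f ((T \<oplus>\<^bsub>A\<^esub> S) i x)"
      using T S adjoint_ops_linear(1)[OF F_selfadjoint] by (simp add: comm)
  qed (auto simp: commutant_alg_def extensional_def)
qed

lemma smult_mem:
  assumes T: "T \<in> commutant_carrier I H F"
  shows "c \<odot>\<^bsub>A\<^esub> T \<in> commutant_carrier I H F"
    and "family_norm I H (c \<odot>\<^bsub>A\<^esub> T) \<le> cmod c * family_norm I H T"
proof -
  have b: "hnorm H ((c \<odot>\<^bsub>A\<^esub> T) i x) \<le> cmod c * family_norm I H T * hnorm H x"
    if "i \<in> I" "x \<in> carrier H" for i x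
    using bound[OF T that] T that by (simp add: hnorm_smult mult_left_mono mult.assoc)
  then show "family_norm I H (c \<odot>\<^bsub>A\<^esub> T) \<le> cmod c * family_norm I H T"
    using T by (intro norm_leI mult_nonneg_nonneg norm_nonneg) auto
  show "c \<odot>\<^bsub>A\<^esub> T \<in> commutant_carrier I H F"
  proof (rule memI[OF _ b, where S = "\<lambda>i x. cnj c \<odot>\<^bsub>H\<^esub> op_adj H (T i) x"])
    fix i assume i: "i \<in> I"
    show "adjoint_ops H ((c \<odot>\<^bsub>A\<^esub> T) i) (\<lambda>x. cnj c \<odot>\<^bsub>H\<^esub> op_adj H (T i) x)"
      by (rule adjoint_opsI) (use i T adjoint_opsD[OF adj[OF T i]] in \<open>auto simp: ip_simps\<close>)
  next
    fix i f x assume "i \<in> I" "f \<in> F" "x \<in> carrier H"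
    then show "(c \<odot>\<^bsub>A\<^esub> T) i (f x) = f ((c \<odot>\<^bsub>A\<^esub> T) i x)"
      using T adjoint_ops_linear(2)[OF F_selfadjoint] by (simp add: comm)
  qed (auto simp: commutant_alg_def extensional_def)
qed

lemma one_mem: "\<one>\<^bsub>A\<^esub> \<in> commutant_carrier I H F"
proof (rule memI[where B = 1 and S = "\<lambda>i x. x"])
  show "adjoint_ops H (\<one>\<^bsub>A\<^esub> i) (\<lambda>x. x)" if "i \<in> I" for i
    by (rule adjoint_opsI) (use that in auto)
qed (auto, auto simp: commutant_alg_def)

lemma zero_mem: "\<zero>\<^bsub>A\<^esub> \<in> commutant_carrier I H F"
proof (rule memI[where B = 1 and S = "\<lambda>i x. \<zero>\<^bsub>H\<^esub>"])
  show "adjoint_ops H (\<zero>\<^bsub>A\<^esub> i) (\<lambda>x. \<zero>\<^bsub>H\<^esub>)" if "i \<in> I" for i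
    by (rule adjoint_opsI) (use that in auto)
qed (auto simp: adjoint_ops_linear(3)[OF F_selfadjoint], auto simp: commutant_alg_def)

lemma ring_A: "ring A"
proof (rule ringI)
  show "abelian_group A"
  proof (rule abelian_groupI)
    fix T assume "T \<in> carrier A"
    then have T: "T \<in> commutant_carrier I H F" by simp
    have "(-1) \<odot>\<^bsub>A\<^esub> T \<oplus>\<^bsub>A\<^esub> T = \<zero>\<^bsub>A\<^esub>"
    proof (rule eqI)
      fix i x assume "i \<in> I" "x \<in> carrier H"
      then show "((-1) \<odot>\<^bsub>A\<^esub> T \<oplus>\<^bsub>A\<^esub> T) i x = \<zero>\<^bsub>A\<^esub> i x"
        using T by (intro eqI_ip) (auto simp: ip_simps)
    qed (use T in \<open>auto intro: add_mem smult_mem zero_mem\<close>)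
    then show "\<exists>S\<in>carrier A. S \<oplus>\<^bsub>A\<^esub> T = \<zero>\<^bsub>A\<^esub>"
      using smult_mem(1)[OF T] by auto
  qed (auto intro!: eqI intro: add_mem zero_mem simp: M.add.m_ac)
  show "Group.monoid A"
    by (rule monoidI) (auto intro!: eqI intro: mult_mem one_mem simp: mult_mem)
qed (auto intro!: eqI intro: mult_mem add_mem
    simp: adjoint_ops_linear(1)[OF adj])

lemma A_uminus_apply:
  assumes "T \<in> commutant_carrier I H F" "i \<in> I" "x \<in> carrier H"
  shows "(\<ominus>\<^bsub>A\<^esub> T) i x = \<ominus>\<^bsub>H\<^esub> (T i x)"
proof -
  interpret A: ring A by (rule ring_A)
  have mem: "\<ominus>\<^bsub>A\<^esub> T \<in> commutant_carrier I H F"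
    using A.a_inv_closed assms by simp
  have "(\<ominus>\<^bsub>A\<^esub> T \<oplus>\<^bsub>A\<^esub> T) i x = \<zero>\<^bsub>A\<^esub> i x"
    using A.l_neg assms by simp
  then have "(\<ominus>\<^bsub>A\<^esub> T) i x \<oplus>\<^bsub>H\<^esub> T i x = \<zero>\<^bsub>H\<^esub>"
    using assms by simp
  then show ?thesis using assms mem M.minus_equality by simp
qed

lemma A_minus_apply:
  assumes "T \<in> commutant_carrier I H F" "S \<in> commutant_carrier I H F" "i \<in> I" "x \<in> carrier H"
  shows "(T \<ominus>\<^bsub>A\<^esub> S) i x = T i x \<ominus>\<^bsub>H\<^esub> S i x"
  using assms A_uminus_apply by (simp add: a_minus_def)

lemma minus_mem:
  assumes "T \<in> commutant_carrier I H F" "S \<in> commutant_carrier I H F"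
  shows "T \<ominus>\<^bsub>A\<^esub> S \<in> commutant_carrier I H F"
proof -
  interpret A: ring A by (rule ring_A)
  show ?thesis using A.minus_closed assms by simp
qed

lemma module_A: "module complex_ring A"
proof (rule moduleI[OF cring_complex_ring])
  show "abelian_group A" using ring_A by (simp add: ring_def)
qed (auto intro!: eqI intro: add_mem smult_mem simp: complex_smult smult_r_distr)

end

context operator_commutant
begin

lemma star_ip:
  assumes "T \<in> commutant_carrier I H F" "i \<in> I" "x \<in> carrier H" "y \<in> carrier H"
  shows "ip H (star A T i x) y = ip H x (T i y)"
  using adjoint_opsD(3)[OF adjoint_ops_sym[OF adj[OF assms(1,2)]]] assms by (simp add: star_apply)

lemma norm_star_le:
  assumes "T \<in> commutant_carrier I H F"
  shows "family_norm I H (star A T) \<le> family_norm I H T"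
  by (rule norm_leI) (use assms norm_nonneg star_bound star_apply in auto)

lemma star_apply_closed [simp]:
  "\<lbrakk>T \<in> commutant_carrier I H F; i \<in> I; x \<in> carrier H\<rbrakk> \<Longrightarrow> star A T i x \<in> carrier H"
  using star_mem by blast

lemma star_eqI:
  assumes "T \<in> commutant_carrier I H F" "S \<in> commutant_carrier I H F"
    and "\<And>i x y. \<lbrakk>i \<in> I; x \<in> carrier H; y \<in> carrier H\<rbrakk> \<Longrightarrow> ip H x (T i y) = ip H (S i x) y"
  shows "star A T = S"
proof (rule eqI)
  fix i x assume ix: "i \<in> I" "x \<in> carrier H"
  show "star A T i x = S i x"
    by (rule eqI_ip) (use assms ix star_ip in auto)
qed (use assms star_mem in auto)

lemma ip_star:
  assumes "T \<in> commutant_carrier I H F" "i \<in> I" "x \<in> carrier H" "y \<in> carrier H"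
  shows "ip H x (star A T i y) = ip H (T i x) y"
  using adjoint_opsD(3)[OF adj[OF assms(1,2)] assms(3,4)] by (simp add: star_apply[OF assms(2)])

text \<open>The nontrivial half is \<open>\<parallel>T x\<parallel>\<^sup>2 = \<langle>T\<^sup>* T x, x\<rangle> \<le> \<parallel>T\<^sup>* T\<parallel> \<parallel>x\<parallel>\<^sup>2\<close>.\<close>

lemma cstar_identity_A:
  assumes T: "T \<in> commutant_carrier I H F"
  shows "family_norm I H (star A T \<otimes>\<^bsub>A\<^esub> T) = (family_norm I H T)\<^sup>2"
proof (rule antisym)
  have "family_norm I H (star A T \<otimes>\<^bsub>A\<^esub> T) \<le> family_norm I H (star A T) * family_norm I H T"
    by (rule mult_mem(2)[OF star_mem[OF T] T])
  also have "\<dots> \<le> family_norm I H T * family_norm I H T"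
    using T by (intro mult_right_mono norm_star_le norm_nonneg)
  finally show "family_norm I H (star A T \<otimes>\<^bsub>A\<^esub> T) \<le> (family_norm I H T)\<^sup>2"
    by (simp add: power2_eq_square)
next
  define N where "N = family_norm I H (star A T \<otimes>\<^bsub>A\<^esub> T)"
  have mem: "star A T \<otimes>\<^bsub>A\<^esub> T \<in> commutant_carrier I H F"
    by (rule mult_mem(1)[OF star_mem[OF T] T])
  have N0: "0 \<le> N" unfolding N_def by (rule norm_nonneg[OF mem])
  have "family_norm I H T \<le> sqrt N"
  proof (rule norm_leI)
    fix i x assume ix: "i \<in> I" "x \<in> carrier H"
    have "(hnorm H (T i x))\<^sup>2 = Re (ip H (star A T i (T i x)) x)"
      using T ix by (simp add: hnorm_sq star_ip)
    also have "\<dots> \<le> hnorm H (star A T i (T i x)) * hnorm H x"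
      using cauchy_schwarz[of "star A T i (T i x)" x] complex_Re_le_cmod[of "ip H (star A T i (T i x)) x"]
        T ix by simp
    also have "\<dots> \<le> N * hnorm H x * hnorm H x"
      using bound[OF mem ix] ix by (intro mult_right_mono) (auto simp: N_def)
    also have "\<dots> = (sqrt N * hnorm H x)\<^sup>2"
      using N0 by (simp add: power2_eq_square)
    finally show "hnorm H (T i x) \<le> sqrt N * hnorm H x"
      by (rule power2_le_imp_le) (use N0 ix in auto)
  qed (use N0 in simp)
  then have "(family_norm I H T)\<^sup>2 \<le> (sqrt N)\<^sup>2"
    using norm_nonneg[OF T] by (intro power_mono)
  then show "(family_norm I H T)\<^sup>2 \<le> N" using N0 by simp
qed

text \<open>Cauchy sequences converge pointwise, and so do their adjoints; the pointwise limits are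
  adjoint to each other, so that the limit is again an adjointable family.  It commutes with \<open>F\<close> because
  in inner products a self-adjoint \<open>f\<close> can be moved to the other argument before the limit is taken.\<close>

lemma complete_A:
  "seq_complete_on (commutant_carrier I H F) (\<lambda>T S. family_norm I H (T \<ominus>\<^bsub>A\<^esub> S))"
  unfolding seq_complete_on_def
proof (intro allI impI)
  fix X :: "nat \<Rightarrow> 'i \<Rightarrow> 'a \<Rightarrow> 'a"
  assume "\<forall>n. X n \<in> commutant_carrier I H F"
  then have X: "X n \<in> commutant_carrier I H F" for n by simp
  assume cauchy: "\<forall>\<epsilon>>0. \<exists>N. \<forall>m\<ge>N. \<forall>n\<ge>N. family_norm I H (X m \<ominus>\<^bsub>A\<^esub> X n) < \<epsilon>"
  have d: "hnorm H (X m i x \<ominus>\<^bsub>H\<^esub> X n i x) \<le> family_norm I H (X m \<ominus>\<^bsub>A\<^esub> X n) * hnorm H x"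
    if "i \<in> I" "x \<in> carrier H" for m n i x
    using bound[OF minus_mem[OF X X] that, of m n] A_minus_apply[OF X X that] by simp
  have ds: "hnorm H (star A (X m) i x \<ominus>\<^bsub>H\<^esub> star A (X n) i x)
      \<le> family_norm I H (X m \<ominus>\<^bsub>A\<^esub> X n) * hnorm H x"
    if ix: "i \<in> I" "x \<in> carrier H" for m n i x
  proof -
    have "star A (X m \<ominus>\<^bsub>A\<^esub> X n) = star A (X m) \<ominus>\<^bsub>A\<^esub> star A (X n)"
      by (rule star_eqI[OF minus_mem[OF X X] minus_mem[OF star_mem[OF X] star_mem[OF X]]])
         (use X in \<open>simp add: A_minus_apply star_mem ip_simps star_ip\<close>)
    then show ?thesis
      using star_bound[OF minus_mem[OF X X] ix, of m n]
        A_minus_apply[OF star_mem[OF X] star_mem[OF X] ix] star_apply[OF ix(1)] by metis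
  qed
  have lim: "\<exists>y\<in>carrier H. (\<lambda>n. hnorm H (Y n \<ominus>\<^bsub>H\<^esub> y)) \<longlonglongrightarrow> 0"
    if Y: "\<And>n. Y n \<in> carrier H" and x: "x \<in> carrier H"
      and le: "\<And>m n. hnorm H (Y m \<ominus>\<^bsub>H\<^esub> Y n) \<le> family_norm I H (X m \<ominus>\<^bsub>A\<^esub> X n) * hnorm H x" for x Y
  proof (rule hnorm_complete[unfolded seq_complete_on_def, rule_format, OF Y])
    fix e :: real assume e: "e > 0"
    define b where "b = hnorm H x + 1"
    have b: "b > 0" using x hnorm_nonneg[OF x] unfolding b_def by linarith
    obtain N where N: "\<And>m n. m \<ge> N \<Longrightarrow> n \<ge> N \<Longrightarrow> family_norm I H (X m \<ominus>\<^bsub>A\<^esub> X n) < e / b"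
      using cauchy e b by (meson divide_pos_pos)
    show "\<exists>N. \<forall>m\<ge>N. \<forall>n\<ge>N. hnorm H (Y m \<ominus>\<^bsub>H\<^esub> Y n) < e"
    proof (intro exI allI impI)
      fix m n assume mn: "m \<ge> N" "n \<ge> N"
      have "hnorm H (Y m \<ominus>\<^bsub>H\<^esub> Y n) \<le> family_norm I H (X m \<ominus>\<^bsub>A\<^esub> X n) * hnorm H x" by (rule le)
      also have "\<dots> \<le> family_norm I H (X m \<ominus>\<^bsub>A\<^esub> X n) * b"
        by (intro mult_left_mono norm_nonneg minus_mem X) (simp add: b_def)
      also have "\<dots> < e / b * b"
        by (intro mult_strict_right_mono N mn b)
      finally show "hnorm H (Y m \<ominus>\<^bsub>H\<^esub> Y n) < e" using b by simp
    qed
  qed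
  have "\<forall>i\<in>I. \<forall>x\<in>carrier H. \<exists>y\<in>carrier H. (\<lambda>n. hnorm H (X n i x \<ominus>\<^bsub>H\<^esub> y)) \<longlonglongrightarrow> 0"
    using X d by (intro ballI lim) auto
  then obtain T0 where T0: "\<And>i x. \<lbrakk>i \<in> I; x \<in> carrier H\<rbrakk> \<Longrightarrow> T0 i x \<in> carrier H"
    "\<And>i x. \<lbrakk>i \<in> I; x \<in> carrier H\<rbrakk> \<Longrightarrow> (\<lambda>n. hnorm H (X n i x \<ominus>\<^bsub>H\<^esub> T0 i x)) \<longlonglongrightarrow> 0"
    by metis
  have "\<forall>i\<in>I. \<forall>x\<in>carrier H. \<exists>y\<in>carrier H. (\<lambda>n. hnorm H (star A (X n) i x \<ominus>\<^bsub>H\<^esub> y)) \<longlonglongrightarrow> 0"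
    using X ds by (intro ballI lim) auto
  then obtain S where S: "\<And>i x. \<lbrakk>i \<in> I; x \<in> carrier H\<rbrakk> \<Longrightarrow> S i x \<in> carrier H"
    "\<And>i x. \<lbrakk>i \<in> I; x \<in> carrier H\<rbrakk> \<Longrightarrow> (\<lambda>n. hnorm H (star A (X n) i x \<ominus>\<^bsub>H\<^esub> S i x)) \<longlonglongrightarrow> 0"
    by metis
  have ip_lim: "(\<lambda>n. ip H (Y n) z) \<longlonglongrightarrow> ip H y z"
    if "\<And>n. Y n \<in> carrier H" "y \<in> carrier H" "z \<in> carrier H" "(\<lambda>n. hnorm H (Y n \<ominus>\<^bsub>H\<^esub> y)) \<longlonglongrightarrow> 0"
    for Y y z
  proof (rule LIM_zero_cancel, rule tendsto_0_le[OF that(4)])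
    have "norm (ip H (Y n) z - ip H y z) \<le> norm (hnorm H (Y n \<ominus>\<^bsub>H\<^esub> y)) * hnorm H z" for n
      using cauchy_schwarz[of "Y n \<ominus>\<^bsub>H\<^esub> y" z] that by (simp add: ip_minus_left)
    then show "\<forall>\<^sub>F n in sequentially.
        norm (ip H (Y n) z - ip H y z) \<le> norm (hnorm H (Y n \<ominus>\<^bsub>H\<^esub> y)) * hnorm H z"
      by simp
  qed
  have le_lim: "hnorm H (T0 i x \<ominus>\<^bsub>H\<^esub> X n i x) \<le> C * hnorm H x"
    if C: "\<And>m. m \<ge> N \<Longrightarrow> family_norm I H (X m \<ominus>\<^bsub>A\<^esub> X n) \<le> C" and ix: "i \<in> I" "x \<in> carrier H"
    for C i x n N
  proof (rule LIMSEQ_le_const)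
    show "(\<lambda>m. hnorm H (X m i x \<ominus>\<^bsub>H\<^esub> T0 i x) + C * hnorm H x) \<longlonglongrightarrow> C * hnorm H x"
      using tendsto_add[OF T0(2)[OF ix] tendsto_const] by simp
    show "\<exists>N. \<forall>m\<ge>N. hnorm H (T0 i x \<ominus>\<^bsub>H\<^esub> X n i x) \<le> hnorm H (X m i x \<ominus>\<^bsub>H\<^esub> T0 i x) + C * hnorm H x"
    proof (intro exI allI impI)
      fix m assume m: "m \<ge> N"
      have cl: "X m i x \<in> carrier H" "X n i x \<in> carrier H" "T0 i x \<in> carrier H"
        using X T0(1) ix by auto
      have "hnorm H (T0 i x \<ominus>\<^bsub>H\<^esub> X n i x)
          \<le> hnorm H (T0 i x \<ominus>\<^bsub>H\<^esub> X m i x) + hnorm H (X m i x \<ominus>\<^bsub>H\<^esub> X n i x)"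
        using cl by (intro hnorm_triangle)
      also have "hnorm H (X m i x \<ominus>\<^bsub>H\<^esub> X n i x) \<le> C * hnorm H x"
        using d[OF ix, of m n] mult_right_mono[OF C[OF m] hnorm_nonneg[OF ix(2)]] by linarith
      finally show "hnorm H (T0 i x \<ominus>\<^bsub>H\<^esub> X n i x) \<le> hnorm H (X m i x \<ominus>\<^bsub>H\<^esub> T0 i x) + C * hnorm H x"
        using hnorm_minus_commute[OF cl(1,3)] by simp
    qed
  qed
  define T where "T = (\<lambda>i\<in>I. \<lambda>x\<in>carrier H. T0 i x)"
  have T_eq: "T i x = T0 i x" if "i \<in> I" "x \<in> carrier H" for i x
    using that by (simp add: T_def)
  obtain N1 where N1: "\<And>m n. m \<ge> N1 \<Longrightarrow> n \<ge> N1 \<Longrightarrow> family_norm I H (X m \<ominus>\<^bsub>A\<^esub> X n) < 1"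
    using cauchy zero_less_one by meson
  have T: "T \<in> commutant_carrier I H F"
  proof (rule memI[where S = S and B = "1 + family_norm I H (X N1)"])
    fix i assume i: "i \<in> I"
    show "adjoint_ops H (T i) (S i)"
    proof (rule adjoint_opsI)
      fix x y assume x: "x \<in> carrier H" and y: "y \<in> carrier H"
      have "(\<lambda>n. ip H (X n i x) y) \<longlonglongrightarrow> ip H (T0 i x) y"
        by (rule ip_lim[OF _ _ y]) (use X i x T0 in auto)
      moreover have "(\<lambda>n. cnj (ip H (star A (X n) i y) x)) \<longlonglongrightarrow> cnj (ip H (S i y) x)"
        by (rule tendsto_cnj, rule ip_lim[OF _ _ x]) (use X i y S in auto)
      moreover have "ip H (X n i x) y = cnj (ip H (star A (X n) i y) x)" for n
        using X i x y ip_star[OF X i x y] ip_commute[of "star A (X n) i y" x] by simp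
      moreover have "ip H x (S i y) = cnj (ip H (S i y) x)"
        using S i x y by (intro ip_commute) auto
      ultimately show "ip H (T i x) y = ip H x (S i y)"
        using LIMSEQ_unique i x by (simp add: T_eq)
    qed (use T0 S i T_eq in auto)
  next
    fix i x assume ix: "i \<in> I" "x \<in> carrier H"
    have cl: "X N1 i x \<in> carrier H" "T0 i x \<in> carrier H"
      using X T0(1) ix by auto
    have "T0 i x = (T0 i x \<ominus>\<^bsub>H\<^esub> X N1 i x) \<oplus>\<^bsub>H\<^esub> X N1 i x"
      by (rule eqI_ip) (use cl in \<open>auto simp: ip_simps\<close>)
    then have "hnorm H (T0 i x) \<le> hnorm H (T0 i x \<ominus>\<^bsub>H\<^esub> X N1 i x) + hnorm H (X N1 i x)"
      using hnorm_add[of "T0 i x \<ominus>\<^bsub>H\<^esub> X N1 i x" "X N1 i x"] cl by simp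
    also have "hnorm H (T0 i x \<ominus>\<^bsub>H\<^esub> X N1 i x) \<le> 1 * hnorm H x"
      by (rule le_lim[of N1, OF _ ix]) (use N1 less_imp_le in auto)
    also have "hnorm H (X N1 i x) \<le> family_norm I H (X N1) * hnorm H x"
      by (rule bound[OF X ix])
    finally show "hnorm H (T i x) \<le> (1 + family_norm I H (X N1)) * hnorm H x"
      by (simp add: T_eq ix distrib_right)
  next
    fix i f x assume i: "i \<in> I" and f: "f \<in> F" and x: "x \<in> carrier H"
    show "T i (f x) = f (T i x)"
    proof (rule eqI_ip)
      fix z assume z: "z \<in> carrier H"
      have "(\<lambda>n. ip H (X n i (f x)) z) \<longlonglongrightarrow> ip H (T0 i (f x)) z"
        by (rule ip_lim[OF _ _ z]) (use X i x f T0 in auto)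
      moreover have "(\<lambda>n. ip H (X n i x) (f z)) \<longlonglongrightarrow> ip H (T0 i x) (f z)"
        by (rule ip_lim) (use X i x f T0 z in auto)
      moreover have "ip H (X n i (f x)) z = ip H (X n i x) (f z)" for n
        using adjoint_opsD(3)[OF F_selfadjoint[OF f]] comm[OF X i f x] X i x z by simp
      moreover have "ip H (f (T0 i x)) z = ip H (T0 i x) (f z)"
        using adjoint_opsD(3)[OF F_selfadjoint[OF f]] T0(1) i x z by simp
      ultimately show "ip H (T i (f x)) z = ip H (f (T i x)) z"
        using LIMSEQ_unique i x f by (simp add: T_eq)
    qed (use i f x T0 T_eq in auto)
  qed (simp_all add: T_def extensional_def)
  show "\<exists>T\<in>commutant_carrier I H F. (\<lambda>n. family_norm I H (X n \<ominus>\<^bsub>A\<^esub> T)) \<longlonglongrightarrow> 0"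
  proof (rule bexI[OF _ T], rule LIMSEQ_I)
    fix r :: real assume r: "r > 0"
    obtain N where N: "\<And>m n. m \<ge> N \<Longrightarrow> n \<ge> N \<Longrightarrow> family_norm I H (X m \<ominus>\<^bsub>A\<^esub> X n) < r / 2"
      using cauchy r half_gt_zero by meson
    show "\<exists>no. \<forall>n\<ge>no. norm (family_norm I H (X n \<ominus>\<^bsub>A\<^esub> T) - 0) < r"
    proof (intro exI allI impI)
      fix n assume n: "n \<ge> N"
      have "family_norm I H (X n \<ominus>\<^bsub>A\<^esub> T) \<le> r / 2"
      proof (rule norm_leI)
        fix i x assume ix: "i \<in> I" "x \<in> carrier H"
        have "hnorm H ((X n \<ominus>\<^bsub>A\<^esub> T) i x) = hnorm H (T0 i x \<ominus>\<^bsub>H\<^esub> X n i x)"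
          using A_minus_apply[OF X T ix] hnorm_minus_commute[of "X n i x" "T0 i x"] X T0(1) ix T_eq
          by simp
        also have "\<dots> \<le> r / 2 * hnorm H x"
          by (rule le_lim[of N, OF _ ix]) (use N n less_imp_le in auto)
        finally show "hnorm H ((X n \<ominus>\<^bsub>A\<^esub> T) i x) \<le> r / 2 * hnorm H x" .
      qed (use r in simp)
      then show "norm (family_norm I H (X n \<ominus>\<^bsub>A\<^esub> T) - 0) < r"
        using norm_nonneg[OF minus_mem[OF X T], of n] r by simp
    qed
  qed
qed

lemma cstar_A: "unital_cstar_algebra A"
proof (intro unital_cstar_algebra.intro unital_cstar_algebra_axioms.intro)
  show "module complex_ring A" by (rule module_A)
  show "ring A" by (rule ring_A)
  show "seq_complete_on (carrier A) (\<lambda>x y. cnorm A (x \<ominus>\<^bsub>A\<^esub> y))"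
    using complete_A by simp
  show "cnorm A (star A x \<otimes>\<^bsub>A\<^esub> x) = (cnorm A x)\<^sup>2" if "x \<in> carrier A" for x
    using cstar_identity_A that by simp
  show "cnorm A x = 0 \<longleftrightarrow> x = \<zero>\<^bsub>A\<^esub>" if "x \<in> carrier A" for x
  proof -
    have x: "x \<in> commutant_carrier I H F" using that by simp
    show ?thesis
    proof
      assume 0: "cnorm A x = 0"
      show "x = \<zero>\<^bsub>A\<^esub>"
      proof (rule eqI[OF x zero_mem])
        fix i z assume iz: "i \<in> I" "z \<in> carrier H"
        have "hnorm H (x i z) \<le> 0" using bound[OF x iz] 0 by simp
        then have "hnorm H (x i z) = 0" using hnorm_nonneg[OF closed[OF x iz]] by linarith
        then show "x i z = \<zero>\<^bsub>A\<^esub> i z" using x iz by simp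
      qed
    next
      assume "x = \<zero>\<^bsub>A\<^esub>"
      then have "family_norm I H x \<le> 0" by (intro norm_leI) auto
      with norm_nonneg[OF x] show "cnorm A x = 0" by simp
    qed
  qed
  show "cnorm A (c \<odot>\<^bsub>A\<^esub> x) = cmod c * cnorm A x" if "x \<in> carrier A" for c x
  proof (cases "c = 0")
    case True
    then show ?thesis
      using smult_mem(2)[of x 0] that norm_nonneg[OF smult_mem(1)[of x 0]] by simp
  next
    case False
    have x: "x \<in> commutant_carrier I H F" using that by simp
    have "x = inverse c \<odot>\<^bsub>A\<^esub> (c \<odot>\<^bsub>A\<^esub> x)"
      by (rule eqI[OF x]) (use x smult_mem False in \<open>auto simp flip: complex_smult(2) simp: complex_smult(3)\<close>)
    then have "family_norm I H x \<le> cmod (inverse c) * family_norm I H (c \<odot>\<^bsub>A\<^esub> x)"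
      using smult_mem(2)[OF smult_mem(1)[OF x], of "inverse c" c] by simp
    then have "cmod c * family_norm I H x \<le> family_norm I H (c \<odot>\<^bsub>A\<^esub> x)"
      using False by (simp add: norm_divide field_simps)
    with smult_mem(2)[OF x, of c] show ?thesis by simp
  qed
  show "star A (star A x) = x" if "x \<in> carrier A" for x
    by (rule star_eqI) (use that star_mem ip_star in auto)
  show "star A (x \<oplus>\<^bsub>A\<^esub> y) = star A x \<oplus>\<^bsub>A\<^esub> star A y" if "x \<in> carrier A" "y \<in> carrier A" for x y
    by (rule star_eqI) (use that star_mem add_mem in \<open>auto simp: star_ip ip_simps\<close>)
  show "star A (c \<odot>\<^bsub>A\<^esub> x) = cnj c \<odot>\<^bsub>A\<^esub> star A x" if "x \<in> carrier A" for c x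
    by (rule star_eqI) (use that star_mem smult_mem in \<open>auto simp: star_ip ip_simps\<close>)
  show "star A (x \<otimes>\<^bsub>A\<^esub> y) = star A y \<otimes>\<^bsub>A\<^esub> star A x" if "x \<in> carrier A" "y \<in> carrier A" for x y
    by (rule star_eqI) (use that star_mem mult_mem in \<open>auto simp: star_ip\<close>)
  show "(c \<odot>\<^bsub>A\<^esub> x) \<otimes>\<^bsub>A\<^esub> y = c \<odot>\<^bsub>A\<^esub> (x \<otimes>\<^bsub>A\<^esub> y)" if "x \<in> carrier A" "y \<in> carrier A" for c x y
    by (rule eqI) (use that mult_mem smult_mem in auto)
  show "x \<otimes>\<^bsub>A\<^esub> (c \<odot>\<^bsub>A\<^esub> y) = c \<odot>\<^bsub>A\<^esub> (x \<otimes>\<^bsub>A\<^esub> y)" if "x \<in> carrier A" "y \<in> carrier A" for c x y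
    by (rule eqI) (use that mult_mem smult_mem in \<open>auto simp: adjoint_ops_linear(2)[OF adj]\<close>)
qed (use star_mem norm_nonneg add_mem(2) mult_mem(2) in \<open>simp_all\<close>)

end

section \<open>Transport of the algebra into the given universe\<close>

definition transport_alg :: "('b \<Rightarrow> 'a) \<Rightarrow> 'b cstar_alg \<Rightarrow> 'a cstar_alg" where
  "transport_alg \<phi> A = (let \<psi> = inv_into (carrier A) \<phi> in
     \<lparr>carrier = \<phi> ` carrier A,
      mult = (\<lambda>x y. \<phi> (\<psi> x \<otimes>\<^bsub>A\<^esub> \<psi> y)),
      one = \<phi> \<one>\<^bsub>A\<^esub>,
      zero = \<phi> \<zero>\<^bsub>A\<^esub>,
      add = (\<lambda>x y. \<phi> (\<psi> x \<oplus>\<^bsub>A\<^esub> \<psi> y)),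
      smult = (\<lambda>c x. \<phi> (c \<odot>\<^bsub>A\<^esub> \<psi> x)),
      star = (\<lambda>x. \<phi> (star A (\<psi> x))),
      cnorm = (\<lambda>x. cnorm A (\<psi> x))\<rparr>)"

context unital_cstar_algebra
begin

lemma complex_smult:
  assumes "x \<in> carrier A"
  shows "(a + b) \<odot>\<^bsub>A\<^esub> x = a \<odot>\<^bsub>A\<^esub> x \<oplus>\<^bsub>A\<^esub> b \<odot>\<^bsub>A\<^esub> x" "(a * b) \<odot>\<^bsub>A\<^esub> x = a \<odot>\<^bsub>A\<^esub> (b \<odot>\<^bsub>A\<^esub> x)"
    "1 \<odot>\<^bsub>A\<^esub> x = x"
  using assms smult_l_distr[of a b x] smult_assoc1[of a b x] smult_one[of x] by simp_all

end

locale cstar_transport = unital_cstar_algebra A for A :: "'b cstar_alg" (structure) +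
  fixes \<phi> :: "'b \<Rightarrow> 'a"
  assumes inj: "inj_on \<phi> (carrier A)"
begin

lemma transport_simps [simp]:
  "carrier (transport_alg \<phi> A) = \<phi> ` carrier A"
  "\<one>\<^bsub>transport_alg \<phi> A\<^esub> = \<phi> \<one>\<^bsub>A\<^esub>"
  "\<zero>\<^bsub>transport_alg \<phi> A\<^esub> = \<phi> \<zero>\<^bsub>A\<^esub>"
  "\<lbrakk>x \<in> carrier A; y \<in> carrier A\<rbrakk> \<Longrightarrow> \<phi> x \<otimes>\<^bsub>transport_alg \<phi> A\<^esub> \<phi> y = \<phi> (x \<otimes>\<^bsub>A\<^esub> y)"
  "\<lbrakk>x \<in> carrier A; y \<in> carrier A\<rbrakk> \<Longrightarrow> \<phi> x \<oplus>\<^bsub>transport_alg \<phi> A\<^esub> \<phi> y = \<phi> (x \<oplus>\<^bsub>A\<^esub> y)"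
  "x \<in> carrier A \<Longrightarrow> c \<odot>\<^bsub>transport_alg \<phi> A\<^esub> \<phi> x = \<phi> (c \<odot>\<^bsub>A\<^esub> x)"
  "x \<in> carrier A \<Longrightarrow> star (transport_alg \<phi> A) (\<phi> x) = \<phi> (star A x)"
  "x \<in> carrier A \<Longrightarrow> cnorm (transport_alg \<phi> A) (\<phi> x) = cnorm A x"
  using inj by (simp_all add: transport_alg_def Let_def)

lemma ring_transport: "ring (transport_alg \<phi> A)"
proof (rule ringI)
  show "abelian_group (transport_alg \<phi> A)"
  proof (rule abelian_groupI)
    fix x assume "x \<in> carrier (transport_alg \<phi> A)"
    then obtain a where "x = \<phi> a" "a \<in> carrier A" by auto
    then show "\<exists>y\<in>carrier (transport_alg \<phi> A). y \<oplus>\<^bsub>transport_alg \<phi> A\<^esub> x = \<zero>\<^bsub>transport_alg \<phi> A\<^esub>"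
      by (auto intro!: bexI[of _ "\<ominus>\<^bsub>A\<^esub> a"] simp: M.l_neg)
  qed (auto simp: M.add.m_ac)
  show "Group.monoid (transport_alg \<phi> A)"
    by (rule monoidI) (auto simp: m_assoc)
qed (auto simp: l_distr r_distr)

lemma minus_transport:
  assumes "x \<in> carrier A" "y \<in> carrier A"
  shows "\<phi> x \<ominus>\<^bsub>transport_alg \<phi> A\<^esub> \<phi> y = \<phi> (x \<ominus>\<^bsub>A\<^esub> y)"
proof -
  interpret B: ring "transport_alg \<phi> A" by (rule ring_transport)
  have "\<ominus>\<^bsub>transport_alg \<phi> A\<^esub> \<phi> y = \<phi> (\<ominus>\<^bsub>A\<^esub> y)"
    by (rule B.minus_equality) (use assms in \<open>auto simp: M.l_neg\<close>)
  then show ?thesis using assms by (simp add: a_minus_def)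
qed

lemma unital_cstar_algebra_transport: "unital_cstar_algebra (transport_alg \<phi> A)"
proof (intro unital_cstar_algebra.intro unital_cstar_algebra_axioms.intro)
  show "ring (transport_alg \<phi> A)" by (rule ring_transport)
  then have "abelian_group (transport_alg \<phi> A)" by (simp add: ring_def)
  then show "module complex_ring (transport_alg \<phi> A)"
    by (intro moduleI[OF cring_complex_ring])
       (auto simp: complex_smult smult_r_distr)
  show "seq_complete_on (carrier (transport_alg \<phi> A))
      (\<lambda>x y. cnorm (transport_alg \<phi> A) (x \<ominus>\<^bsub>transport_alg \<phi> A\<^esub> y))"
    unfolding seq_complete_on_def
  proof (intro allI impI)
    fix X :: "nat \<Rightarrow> 'a"
    assume "\<forall>n. X n \<in> carrier (transport_alg \<phi> A)"
    then have "\<forall>n. \<exists>a. a \<in> carrier A \<and> X n = \<phi> a" by auto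
    then obtain Y where Y: "\<And>n. Y n \<in> carrier A" and X: "X = (\<lambda>n. \<phi> (Y n))"
      using choice[of "\<lambda>n a. a \<in> carrier A \<and> X n = \<phi> a"] by auto
    assume "\<forall>\<epsilon>>0. \<exists>N. \<forall>m\<ge>N. \<forall>n\<ge>N.
      cnorm (transport_alg \<phi> A) (X m \<ominus>\<^bsub>transport_alg \<phi> A\<^esub> X n) < \<epsilon>"
    then have "\<forall>\<epsilon>>0. \<exists>N. \<forall>m\<ge>N. \<forall>n\<ge>N. cnorm A (Y m \<ominus>\<^bsub>A\<^esub> Y n) < \<epsilon>"
      using Y by (simp add: X minus_transport)
    then obtain y where "y \<in> carrier A" "(\<lambda>n. cnorm A (Y n \<ominus>\<^bsub>A\<^esub> y)) \<longlonglongrightarrow> 0"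
      using cnorm_complete Y unfolding seq_complete_on_def by blast
    then show "\<exists>x\<in>carrier (transport_alg \<phi> A).
        (\<lambda>n. cnorm (transport_alg \<phi> A) (X n \<ominus>\<^bsub>transport_alg \<phi> A\<^esub> x)) \<longlonglongrightarrow> 0"
      using Y by (auto intro!: bexI[of _ "\<phi> y"] simp: X minus_transport)
  qed
  show "cnorm (transport_alg \<phi> A) x = 0 \<longleftrightarrow> x = \<zero>\<^bsub>transport_alg \<phi> A\<^esub>"
    if x: "x \<in> carrier (transport_alg \<phi> A)" for x
  proof -
    obtain a where a: "a \<in> carrier A" "x = \<phi> a" using x by auto
    then show ?thesis using cnorm_eq_0[OF a(1)] inj_onD[OF inj, of a "\<zero>\<^bsub>A\<^esub>"] by auto
  qed
qed (auto simp: smult_mult_left smult_mult_right star_closed star_star star_add star_smult star_mult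
    cnorm_nonneg cnorm_add cnorm_smult cnorm_mult cstar_identity)

lemma tracial_state_transport:
  assumes "tracial_state A s"
  shows "tracial_state (transport_alg \<phi> A) (\<lambda>x. s (inv_into (carrier A) \<phi> x))"
  using assms inj star_closed by (auto simp: tracial_state_def cstar_state_def)

lemma cstar_projection_transport:
  "cstar_projection A e \<Longrightarrow> cstar_projection (transport_alg \<phi> A) (\<phi> e)"
  by (auto simp: cstar_projection_def)

end

text \<open>A tracial value may be witnessed by an algebra on any type, provided that its carrier injects
  into the universe.\<close>

lemma tracial_values_transportI:
  fixes A :: "'b cstar_alg" and G :: "'v pair_pre_digraph"
  assumes A: "unital_cstar_algebra A" and inj: "carrier A \<lesssim> (UNIV :: 'a set)"
    and s: "tracial_state A s" and e: "\<And>v. v \<in> pverts G \<Longrightarrow> cstar_projection A (e v)"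
    and orth: "\<And>v w. (v, w) \<in> parcs G \<Longrightarrow> e v \<otimes>\<^bsub>A\<^esub> e w = \<zero>\<^bsub>A\<^esub>"
    and arcs: "parcs G \<subseteq> pverts G \<times> pverts G"
    and u: "\<And>v. v \<in> pverts G \<Longrightarrow> s (e v) = complex_of_real u"
  shows "u \<in> tracial_values TYPE('a) G"
proof -
  obtain \<phi> :: "'b \<Rightarrow> 'a" where \<phi>: "inj_on \<phi> (carrier A)"
    using inj unfolding lepoll_def by blast
  interpret cstar_transport A \<phi> by (intro cstar_transport.intro A cstar_transport_axioms.intro \<phi>)
  have ec: "e v \<in> carrier A" if "v \<in> pverts G" for v
    using e[OF that] by (simp add: cstar_projection_def)
  have "\<phi> (e v) \<otimes>\<^bsub>transport_alg \<phi> A\<^esub> \<phi> (e w) = \<zero>\<^bsub>transport_alg \<phi> A\<^esub>" if "(v, w) \<in> parcs G" for v w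
    using that arcs ec orth \<phi> by (subst transport_simps(4)) auto
  moreover have "s (inv_into (carrier A) \<phi> (\<phi> (e v))) = complex_of_real u" if "v \<in> pverts G" for v
    using u ec \<phi> that by simp
  ultimately show ?thesis
    unfolding tracial_values_def mem_Collect_eq
    using unital_cstar_algebra_transport tracial_state_transport[OF s] cstar_projection_transport[OF e]
    by (intro exI[of _ "transport_alg \<phi> A"] exI[of _ "\<lambda>x. s (inv_into (carrier A) \<phi> x)"]
        exI[of _ "\<lambda>v. \<phi> (e v)"]) auto
qed

subsection \<open>Cardinality of double sequences of complex numbers\<close>

text \<open>A real number is coded by a set of natural numbers; the codes of the real and imaginary
  parts of all entries are packed into one set with the pairing function, parity telling the two apart.\<close>

lemma complex_sequences_lepoll_reals: "(UNIV :: (nat \<Rightarrow> nat \<Rightarrow> complex) set) \<lesssim> (UNIV :: real set)"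
proof -
  obtain f :: "real \<Rightarrow> nat set" where f: "inj f"
    using eqpoll_sym[OF nat_sets_eqpoll_reals] unfolding eqpoll_def bij_betw_def by blast
  define code :: "(nat \<Rightarrow> nat \<Rightarrow> complex) \<Rightarrow> nat set" where
    "code x = {k. \<exists>i j m. k = prod_encode (prod_encode (i, j), 2 * m) \<and> m \<in> f (Re (x i j)) \<or>
       k = prod_encode (prod_encode (i, j), 2 * m + 1) \<and> m \<in> f (Im (x i j))}" for x
  have Re: "prod_encode (prod_encode (i, j), 2 * m) \<in> code x \<longleftrightarrow> m \<in> f (Re (x i j))" for x i j m
    by (auto simp: code_def) presburger+
  have Im: "prod_encode (prod_encode (i, j), 2 * m + 1) \<in> code x \<longleftrightarrow> m \<in> f (Im (x i j))" for x i j m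
    by (auto simp: code_def) presburger+
  have "inj code"
  proof (rule injI)
    fix x y assume eq: "code x = code y"
    have "f (Re (x i j)) = f (Re (y i j))" "f (Im (x i j)) = f (Im (y i j))" for i j
      using Re[of i j _ x] Re[of i j _ y] Im[of i j _ x] Im[of i j _ y] eq by auto
    then show "x = y" by (simp add: inj_eq[OF f] fun_eq_iff complex_eq_iff)
  qed
  then have "(UNIV :: (nat \<Rightarrow> nat \<Rightarrow> complex) set) \<lesssim> (UNIV :: nat set set)"
    unfolding lepoll_def by blast
  then show ?thesis using nat_sets_eqpoll_reals lepoll_trans2 by blast
qed

section \<open>Mirrored pairs of operator families\<close>

text \<open>The pairs of a noncommutative polynomial in the operators \<open>E a\<close> and its adjoint.  New letters are
  added on the right, so that an induction step has the letter act directly on the vector \<open>\<xi>\<close>.\<close>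

inductive op_poly :: "'h hilbert \<Rightarrow> 'l set \<Rightarrow> ('l \<Rightarrow> 'h \<Rightarrow> 'h) \<Rightarrow> ('h \<Rightarrow> 'h) \<Rightarrow> ('h \<Rightarrow> 'h) \<Rightarrow> bool"
  for H :: "'h hilbert" and L E where
  unit: "op_poly H L E (\<lambda>x. x) (\<lambda>x. x)"
| add: "\<lbrakk>op_poly H L E Q Q'; op_poly H L E R R'\<rbrakk> \<Longrightarrow>
    op_poly H L E (\<lambda>x. Q x \<oplus>\<^bsub>H\<^esub> R x) (\<lambda>x. Q' x \<oplus>\<^bsub>H\<^esub> R' x)"
| smult: "op_poly H L E Q Q' \<Longrightarrow> op_poly H L E (\<lambda>x. c \<odot>\<^bsub>H\<^esub> Q x) (\<lambda>x. cnj c \<odot>\<^bsub>H\<^esub> Q' x)"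
| mult: "\<lbrakk>op_poly H L E Q Q'; a \<in> L\<rbrakk> \<Longrightarrow> op_poly H L E (\<lambda>x. Q (E a x)) (\<lambda>x. E a (Q' x))"

text \<open>Two commuting families of self-adjoint contractions that act in the same way on one vector.  That is all
  which the construction of the trace takes from a synchronous correlation.\<close>

locale mirrored_pair = hilbert_space H for H (structure) +
  fixes L :: "'l set" and E F :: "'l \<Rightarrow> 'a \<Rightarrow> 'a" and \<xi> :: 'a
  assumes E_sa: "a \<in> L \<Longrightarrow> adjoint_ops H (E a) (E a)"
    and F_sa: "a \<in> L \<Longrightarrow> adjoint_ops H (F a) (F a)"
    and E_contraction: "\<lbrakk>a \<in> L; x \<in> carrier H\<rbrakk> \<Longrightarrow> hnorm H (E a x) \<le> hnorm H x"
    and F_contraction: "\<lbrakk>a \<in> L; x \<in> carrier H\<rbrakk> \<Longrightarrow> hnorm H (F a x) \<le> hnorm H x"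
    and EF_commute: "\<lbrakk>a \<in> L; b \<in> L; x \<in> carrier H\<rbrakk> \<Longrightarrow> E a (F b x) = F b (E a x)"
    and xi_closed [simp]: "\<xi> \<in> carrier H"
    and mirror: "a \<in> L \<Longrightarrow> E a \<xi> = F a \<xi>"
begin

abbreviation poly where "poly \<equiv> op_poly H L E"

text \<open>The adjoint is carried along as a second argument, since \<open>op_adj\<close> would be extensional while
  the operators here are not.\<close>

definition in_commutant :: "('a \<Rightarrow> 'a) \<Rightarrow> ('a \<Rightarrow> 'a) \<Rightarrow> bool" where
  "in_commutant T S \<longleftrightarrow> adjoint_ops H T S \<and> (\<forall>a\<in>L. \<forall>x\<in>carrier H. T (F a x) = F a (T x))"

lemma E_closed [simp]: "a \<in> L \<Longrightarrow> x \<in> carrier H \<Longrightarrow> E a x \<in> carrier H"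
  using adjoint_opsD[OF E_sa] by blast

lemma F_closed [simp]: "a \<in> L \<Longrightarrow> x \<in> carrier H \<Longrightarrow> F a x \<in> carrier H"
  using adjoint_opsD[OF F_sa] by blast

lemma in_commutantD:
  assumes "in_commutant T S"
  shows "adjoint_ops H T S" "\<lbrakk>a \<in> L; x \<in> carrier H\<rbrakk> \<Longrightarrow> T (F a x) = F a (T x)"
    "x \<in> carrier H \<Longrightarrow> T x \<in> carrier H" "x \<in> carrier H \<Longrightarrow> S x \<in> carrier H"
  using assms by (auto simp: in_commutant_def adjoint_ops_def)

lemma in_commutant_sym:
  assumes "in_commutant T S" shows "in_commutant S T"
  unfolding in_commutant_def
proof (intro conjI ballI)
  note D = in_commutantD[OF assms]
  show S: "adjoint_ops H S T" by (rule adjoint_ops_sym[OF D(1)])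
  fix a x assume a: "a \<in> L" and x: "x \<in> carrier H"
  show "S (F a x) = F a (S x)"
  proof (rule eqI_ip)
    fix z assume z: "z \<in> carrier H"
    show "ip H (S (F a x)) z = ip H (F a (S x)) z"
      using a x z D adjoint_opsD(3)[OF S] adjoint_opsD(3)[OF F_sa[OF a]] by simp
  qed (use a x D in auto)
qed

lemma in_commutant_id: "in_commutant (\<lambda>x. x) (\<lambda>x. x)"
  by (auto simp: in_commutant_def adjoint_ops_def)

lemma in_commutant_add:
  assumes "in_commutant T S" "in_commutant T' S'"
  shows "in_commutant (\<lambda>x. T x \<oplus>\<^bsub>H\<^esub> T' x) (\<lambda>x. S x \<oplus>\<^bsub>H\<^esub> S' x)"
  unfolding in_commutant_def
proof (intro conjI ballI)
  note D = in_commutantD[OF assms(1)] and D' = in_commutantD[OF assms(2)]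
  show "adjoint_ops H (\<lambda>x. T x \<oplus>\<^bsub>H\<^esub> T' x) (\<lambda>x. S x \<oplus>\<^bsub>H\<^esub> S' x)"
    by (rule adjoint_opsI)
       (use D D' adjoint_opsD(3)[OF D(1)] adjoint_opsD(3)[OF D'(1)] in \<open>simp_all add: ip_simps\<close>)
  show "T (F a x) \<oplus>\<^bsub>H\<^esub> T' (F a x) = F a (T x \<oplus>\<^bsub>H\<^esub> T' x)" if "a \<in> L" "x \<in> carrier H" for a x
    using that D D' adjoint_ops_linear(1)[OF F_sa] by simp
qed

lemma in_commutant_smult:
  assumes "in_commutant T S"
  shows "in_commutant (\<lambda>x. c \<odot>\<^bsub>H\<^esub> T x) (\<lambda>x. cnj c \<odot>\<^bsub>H\<^esub> S x)"
  unfolding in_commutant_def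
proof (intro conjI ballI)
  note D = in_commutantD[OF assms(1)]
  show "adjoint_ops H (\<lambda>x. c \<odot>\<^bsub>H\<^esub> T x) (\<lambda>x. cnj c \<odot>\<^bsub>H\<^esub> S x)"
    by (rule adjoint_opsI) (use D adjoint_opsD(3)[OF D(1)] in \<open>simp_all add: ip_simps\<close>)
  show "c \<odot>\<^bsub>H\<^esub> T (F a x) = F a (c \<odot>\<^bsub>H\<^esub> T x)" if "a \<in> L" "x \<in> carrier H" for a x
    using that D adjoint_ops_linear(2)[OF F_sa] by simp
qed

lemma in_commutant_comp:
  assumes "in_commutant T S" "in_commutant T' S'"
  shows "in_commutant (\<lambda>x. T (T' x)) (\<lambda>x. S' (S x))"
  unfolding in_commutant_def
proof (intro conjI ballI)
  note D = in_commutantD[OF assms(1)] and D' = in_commutantD[OF assms(2)]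
  show "adjoint_ops H (\<lambda>x. T (T' x)) (\<lambda>x. S' (S x))"
    by (rule adjoint_opsI)
       (use D D' adjoint_opsD(3)[OF D(1)] adjoint_opsD(3)[OF D'(1)] in simp_all)
qed (use in_commutantD[OF assms(1)] in_commutantD[OF assms(2)] in simp)

lemma in_commutant_E: "a \<in> L \<Longrightarrow> in_commutant (E a) (E a)"
  using E_sa EF_commute by (auto simp: in_commutant_def)

lemma poly_in_commutant: "poly Q Q' \<Longrightarrow> in_commutant Q Q'"
  by (induction rule: op_poly.induct)
     (auto intro: in_commutant_id in_commutant_add in_commutant_smult in_commutant_comp in_commutant_E)

lemma poly_closed [simp]: "poly Q Q' \<Longrightarrow> x \<in> carrier H \<Longrightarrow> Q x \<in> carrier H"
  and poly_closed' [simp]: "poly Q Q' \<Longrightarrow> x \<in> carrier H \<Longrightarrow> Q' x \<in> carrier H"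
  using poly_in_commutant in_commutantD by blast+

lemma poly_commute_F: "\<lbrakk>poly Q Q'; a \<in> L; x \<in> carrier H\<rbrakk> \<Longrightarrow> Q (F a x) = F a (Q x)"
  using poly_in_commutant in_commutantD(2) by blast

text \<open>Polynomials grow on the right; invariance of the cyclic subspace under \<open>E\<close> needs growth on the
  left.\<close>

lemma poly_left_mult:
  assumes "poly Q Q'" "a \<in> L"
  shows "\<exists>R R'. poly R R' \<and> (\<forall>x\<in>carrier H. R x = E a (Q x))"
  using assms(1)
proof (induction rule: op_poly.induct)
  case unit
  then show ?case using op_poly.mult[OF op_poly.unit assms(2)] by fastforce
next
  case (add Q Q' P P')
  then obtain R R' S S' where "poly R R'" "\<forall>x\<in>carrier H. R x = E a (Q x)"
    "poly S S'" "\<forall>x\<in>carrier H. S x = E a (P x)" by blast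
  then have "poly (\<lambda>x. R x \<oplus>\<^bsub>H\<^esub> S x) (\<lambda>x. R' x \<oplus>\<^bsub>H\<^esub> S' x)"
    "\<forall>x\<in>carrier H. R x \<oplus>\<^bsub>H\<^esub> S x = E a (Q x \<oplus>\<^bsub>H\<^esub> P x)"
    using op_poly.add add.hyps adjoint_ops_linear(1)[OF E_sa[OF assms(2)]] by auto
  then show ?case by blast
next
  case (smult Q Q' c)
  then obtain R R' where "poly R R'" "\<forall>x\<in>carrier H. R x = E a (Q x)" by blast
  then have "poly (\<lambda>x. c \<odot>\<^bsub>H\<^esub> R x) (\<lambda>x. cnj c \<odot>\<^bsub>H\<^esub> R' x)"
    "\<forall>x\<in>carrier H. c \<odot>\<^bsub>H\<^esub> R x = E a (c \<odot>\<^bsub>H\<^esub> Q x)"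
    using op_poly.smult smult.hyps adjoint_ops_linear(2)[OF E_sa[OF assms(2)]] by auto
  then show ?case by blast
next
  case (mult Q Q' b)
  then obtain R R' where "poly R R'" "\<forall>x\<in>carrier H. R x = E a (Q x)" by blast
  then have "poly (\<lambda>x. R (E b x)) (\<lambda>x. E b (R' x))" "\<forall>x\<in>carrier H. R (E b x) = E a (Q (E b x))"
    using op_poly.mult mult.hyps by auto
  then show ?case by blast
qed

text \<open>The heart of the trace property.  The last letter \<open>E a\<close> of the polynomial acts on \<open>\<xi>\<close> and can be replaced
  by \<open>F a\<close>, which commutes with everything before it; it passes to the right-hand side of the inner product,
  travels back to \<open>\<xi>\<close> and becomes \<open>E a\<close> again.  For this last move \<open>R\<close> has to be an arbitrary member of the
  commutant, although it is the identity in the applications.\<close>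

lemma poly_swap:
  assumes "poly Q Q'" "in_commutant T S" "in_commutant R U"
  shows "ip H (T (Q \<xi>)) (R \<xi>) = ip H (T \<xi>) (R (Q' \<xi>))"
  using assms
proof (induction arbitrary: R U rule: op_poly.induct)
  case unit
  then show ?case by simp
next
  case (add Q Q' P P')
  note D = in_commutantD[OF add.prems(1)] in_commutantD[OF add.prems(2)]
  show ?case
    using add.IH[OF add.prems] add.hyps D
    by (simp add: adjoint_ops_linear(1)[OF D(1)] adjoint_ops_linear(1)[OF D(5)] ip_simps)
next
  case (smult Q Q' c)
  note D = in_commutantD[OF smult.prems(1)] in_commutantD[OF smult.prems(2)]
  show ?case
    using smult.IH[OF smult.prems] smult.hyps D
    by (simp add: adjoint_ops_linear(2)[OF D(1)] adjoint_ops_linear(2)[OF D(5)] ip_simps)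
next
  case (mult Q Q' a)
  note D = in_commutantD[OF mult.prems(1)] in_commutantD[OF mult.prems(2)]
  have "T (Q (E a \<xi>)) = F a (T (Q \<xi>))"
    using mult.hyps D by (simp add: mirror poly_commute_F)
  then have "ip H (T (Q (E a \<xi>))) (R \<xi>) = ip H (T (Q \<xi>)) (F a (R \<xi>))"
    using mult.hyps D adjoint_opsD(3)[OF F_sa[OF \<open>a \<in> L\<close>]] by simp
  also have "F a (R \<xi>) = R (E a \<xi>)"
    using mult.hyps D by (simp add: mirror)
  also have "ip H (T (Q \<xi>)) (R (E a \<xi>)) = ip H (T \<xi>) (R (E a (Q' \<xi>)))"
    using mult.IH[OF mult.prems(1) in_commutant_comp[OF mult.prems(2) in_commutant_E[OF \<open>a \<in> L\<close>]]] .
  finally show ?case .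
qed

text \<open>The case \<open>\<tau>(Q' Q) = \<tau>(Q Q')\<close> of the trace property.\<close>

lemma poly_norm_adjoint:
  assumes "poly Q Q'" shows "hnorm H (Q' \<xi>) = hnorm H (Q \<xi>)"
proof -
  have 1: "in_commutant Q' Q" by (rule in_commutant_sym[OF poly_in_commutant[OF assms]])
  have "ip H (Q' (Q \<xi>)) \<xi> = ip H (Q' \<xi>) (Q' \<xi>)"
    using poly_swap[OF assms 1 in_commutant_id] .
  moreover have "ip H (Q' (Q \<xi>)) \<xi> = ip H (Q \<xi>) (Q \<xi>)"
    using adjoint_opsD(3)[OF in_commutantD(1)[OF 1], of "Q \<xi>" \<xi>] assms by simp
  ultimately show ?thesis by (simp add: hnorm_def)
qed

end

locale cyclic_mirrored_pair = mirrored_pair +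
  assumes cyclic: "\<lbrakk>x \<in> carrier H; 0 < \<epsilon>\<rbrakk> \<Longrightarrow> \<exists>Q Q'. op_poly H L E Q Q' \<and> hnorm H (x \<ominus>\<^bsub>H\<^esub> Q \<xi>) < \<epsilon>"
begin

lemma orthogonal_to_poly:
  assumes w: "w \<in> carrier H" and orth: "\<And>Q Q'. poly Q Q' \<Longrightarrow> ip H w (Q \<xi>) = 0"
  shows "w = \<zero>\<^bsub>H\<^esub>"
proof (rule ccontr)
  assume "w \<noteq> \<zero>\<^bsub>H\<^esub>"
  then have pos: "hnorm H w > 0" using w hnorm_nonneg[OF w] by (simp add: order.strict_iff_order)
  obtain Q Q' where Q: "poly Q Q'" "hnorm H (w \<ominus>\<^bsub>H\<^esub> Q \<xi>) < hnorm H w"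
    using cyclic[OF w pos] by blast
  have "(hnorm H w)\<^sup>2 = Re (ip H w (w \<ominus>\<^bsub>H\<^esub> Q \<xi>))"
    using w Q orth[OF Q(1)] by (simp add: hnorm_sq ip_simps)
  also have "\<dots> \<le> hnorm H w * hnorm H (w \<ominus>\<^bsub>H\<^esub> Q \<xi>)"
    using cauchy_schwarz[of w "w \<ominus>\<^bsub>H\<^esub> Q \<xi>"] complex_Re_le_cmod[of "ip H w (w \<ominus>\<^bsub>H\<^esub> Q \<xi>)"] w Q by simp
  also have "\<dots> < hnorm H w * hnorm H w" using Q(2) pos by simp
  finally show False by (simp add: power2_eq_square)
qed

text \<open>By linearity it suffices to consider monomials; the word \<open>u\<close> in the induction collects the letters
  that have been split off on the right.\<close>

lemma orthogonal_to_words: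
  assumes w: "w \<in> carrier H" and orth: "\<And>u. u \<in> lists L \<Longrightarrow> ip H w (foldr E u \<xi>) = 0"
  shows "w = \<zero>\<^bsub>H\<^esub>"
proof (rule orthogonal_to_poly[OF w])
  have word: "foldr E u \<xi> \<in> carrier H" if "u \<in> lists L" for u
    using that by (induction u) auto
  have "ip H w (Q (foldr E u \<xi>)) = 0" if "poly Q Q'" "u \<in> lists L" for Q Q' u
    using that
  proof (induction arbitrary: u rule: op_poly.induct)
    case (mult Q Q' a)
    then show ?case using mult.IH[of "a # u"] by simp
  qed (use orth word w in \<open>simp_all add: ip_simps\<close>)
  from this[of _ _ "[]"] show "ip H w (Q \<xi>) = 0" if "poly Q Q'" for Q Q' using that by simp
qed

text \<open>If \<open>T\<close> kills \<open>\<xi>\<close>, then \<open>T Q E\<^sub>a \<xi> = T Q F\<^sub>a \<xi> = F\<^sub>a T Q \<xi>\<close> shows inductively that it kills the dense set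
  of all \<open>Q \<xi>\<close>.\<close>

lemma separating:
  assumes T: "in_commutant T S" and 0: "T \<xi> = \<zero>\<^bsub>H\<^esub>" and x: "x \<in> carrier H"
  shows "T x = \<zero>\<^bsub>H\<^esub>"
proof (rule eqI_ip)
  note D = in_commutantD[OF T]
  have poly0: "T (Q \<xi>) = \<zero>\<^bsub>H\<^esub>" if "poly Q Q'" for Q Q'
    using that
  proof (induction rule: op_poly.induct)
    case (mult Q Q' a)
    then have "T (Q (E a \<xi>)) = F a (T (Q \<xi>))"
      using D by (simp add: mirror poly_commute_F)
    then show ?case using mult adjoint_ops_linear(3)[OF F_sa] by simp
  qed (use 0 adjoint_ops_linear[OF D(1)] in simp_all)
  fix z assume z: "z \<in> carrier H"
  have "S z = \<zero>\<^bsub>H\<^esub>"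
    by (rule orthogonal_to_poly)
       (use D z adjoint_opsD(3)[OF adjoint_ops_sym[OF D(1)]] poly0 in auto)
  then show "ip H (T x) z = ip H \<zero>\<^bsub>H\<^esub> z"
    using adjoint_opsD(3)[OF D(1) x z] x z by simp
qed (use in_commutantD[OF T] x in auto)

text \<open>Approximate \<open>T \<xi>\<close> by \<open>Q \<xi>\<close>.  The lemmas \<open>poly_swap\<close> and \<open>poly_norm_adjoint\<close> turn
  \<open>0 \<le> \<parallel>S \<xi> - Q' \<xi>\<parallel>\<^sup>2\<close> into \<open>0 \<le> \<parallel>S \<xi>\<parallel>\<^sup>2 - \<parallel>T \<xi>\<parallel>\<^sup>2 + \<parallel>T \<xi> - Q \<xi>\<parallel>\<^sup>2\<close>.  Applied to \<open>S\<close> as well, this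
  gives equality of the two norms.\<close>

lemma norm_le_adjoint:
  assumes T: "in_commutant T S"
  shows "(hnorm H (T \<xi>))\<^sup>2 \<le> (hnorm H (S \<xi>))\<^sup>2"
proof (rule field_le_epsilon)
  fix e :: real assume e: "e > 0"
  note D = in_commutantD[OF T]
  obtain Q Q' where Q: "poly Q Q'" and d: "hnorm H (T \<xi> \<ominus>\<^bsub>H\<^esub> Q \<xi>) < sqrt e"
    using cyclic[of "T \<xi>" "sqrt e"] D e by auto
  have cl: "Q \<xi> \<in> carrier H" "Q' \<xi> \<in> carrier H" "T \<xi> \<in> carrier H" "S \<xi> \<in> carrier H"
    using Q D by auto
  have "ip H (S \<xi>) (Q' \<xi>) = ip H (S (Q \<xi>)) \<xi>"
    using poly_swap[OF Q in_commutant_sym[OF T] in_commutant_id] by simp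
  also have "\<dots> = ip H (Q \<xi>) (T \<xi>)"
    using adjoint_opsD(3)[OF adjoint_ops_sym[OF D(1)]] cl by simp
  finally have SQ: "ip H (S \<xi>) (Q' \<xi>) = ip H (Q \<xi>) (T \<xi>)" .
  have sq: "(hnorm H (x \<ominus>\<^bsub>H\<^esub> y))\<^sup>2 = (hnorm H x)\<^sup>2 + (hnorm H y)\<^sup>2 - 2 * Re (ip H x y)"
    if "x \<in> carrier H" "y \<in> carrier H" for x y
    using that ip_commute[of x y] by (simp add: hnorm_sq ip_simps)
  have "0 \<le> (hnorm H (S \<xi> \<ominus>\<^bsub>H\<^esub> Q' \<xi>))\<^sup>2" by simp
  also have "\<dots> = (hnorm H (S \<xi>))\<^sup>2 + (hnorm H (Q \<xi>))\<^sup>2 - 2 * Re (ip H (T \<xi>) (Q \<xi>))"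
    using sq[OF cl(4,2)] SQ poly_norm_adjoint[OF Q] ip_commute[OF cl(3,1)] by simp
  also have "\<dots> = (hnorm H (S \<xi>))\<^sup>2 - (hnorm H (T \<xi>))\<^sup>2 + (hnorm H (T \<xi> \<ominus>\<^bsub>H\<^esub> Q \<xi>))\<^sup>2"
    using sq[OF cl(3,1)] by simp
  also have "(hnorm H (T \<xi> \<ominus>\<^bsub>H\<^esub> Q \<xi>))\<^sup>2 \<le> (sqrt e)\<^sup>2"
    using d cl by (intro power_mono) auto
  finally show "(hnorm H (T \<xi>))\<^sup>2 \<le> (hnorm H (S \<xi>))\<^sup>2 + e" using e by simp
qed

lemma norm_adjoint:
  assumes "in_commutant T S" shows "(hnorm H (T \<xi>))\<^sup>2 = (hnorm H (S \<xi>))\<^sup>2"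
  using norm_le_adjoint[OF assms] norm_le_adjoint[OF in_commutant_sym[OF assms]] by simp

text \<open>Polarisation of \<open>\<parallel>T \<xi>\<parallel> = \<parallel>T\<^sup>* \<xi>\<parallel>\<close>.\<close>

lemma trace:
  assumes T: "in_commutant T T'" and S: "in_commutant S S'"
  shows "ip H (T (S \<xi>)) \<xi> = ip H (S (T \<xi>)) \<xi>"
proof -
  note D = in_commutantD[OF T] in_commutantD[OF S]
  have cl: "S \<xi> \<in> carrier H" "S' \<xi> \<in> carrier H" "T \<xi> \<in> carrier H" "T' \<xi> \<in> carrier H"
    using D by auto
  have sq: "(hnorm H (x \<oplus>\<^bsub>H\<^esub> y))\<^sup>2 = (hnorm H x)\<^sup>2 + (hnorm H y)\<^sup>2 + 2 * Re (ip H x y)"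
    if "x \<in> carrier H" "y \<in> carrier H" for x y
    using that ip_commute[of x y] by (simp add: hnorm_sq ip_simps)
  have T': "in_commutant T' T" by (rule in_commutant_sym[OF T])
  have "Re (ip H (S \<xi>) (T' \<xi>)) = Re (ip H (S' \<xi>) (T \<xi>))"
    using norm_adjoint[OF in_commutant_add[OF S T']] norm_adjoint[OF S] norm_adjoint[OF T']
    by (simp add: sq cl)
  moreover have "Im (ip H (S \<xi>) (T' \<xi>)) = - Im (ip H (S' \<xi>) (T \<xi>))"
    using norm_adjoint[OF in_commutant_add[OF S in_commutant_smult[OF T', of \<i>]]]
      norm_adjoint[OF S] norm_adjoint[OF T']
    by (simp add: sq cl hnorm_smult ip_smult_right)
  ultimately have "ip H (S \<xi>) (T' \<xi>) = ip H (T \<xi>) (S' \<xi>)"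
    using ip_commute[OF cl(2,3)] by (simp add: complex_eq_iff)
  then show ?thesis
    using adjoint_opsD(3)[OF D(1) cl(1) xi_closed] adjoint_opsD(3)[OF D(5) cl(3) xi_closed] by simp
qed

end

context cyclic_mirrored_pair
begin

lemma operator_commutant_F: "operator_commutant H (F ` L)"
  by unfold_locales (use F_sa in auto)

context
  fixes I :: "nat set"
begin

interpretation operator_commutant H I "F ` L"
  by (rule operator_commutant_F)

lemma component_in_commutant:
  assumes "T \<in> commutant_carrier I H (F ` L)" "i \<in> I"
  shows "in_commutant (T i) (star A T i)"
  using adj[OF assms] comm[OF assms] assms(2) unfolding in_commutant_def star_apply[OF assms(2)] by auto

lemma tracial_state_A:
  assumes I: "finite I" "I \<noteq> {}" and \<xi>: "hnorm H \<xi> = 1"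
  shows "tracial_state A (\<lambda>T. (\<Sum>i\<in>I. ip H (T i \<xi>) \<xi>) / of_nat (card I))"
proof -
  have pos: "ip H (star A T i (T i \<xi>)) \<xi> = of_real ((hnorm H (T i \<xi>))\<^sup>2)"
    if "T \<in> commutant_carrier I H (F ` L)" "i \<in> I" for T i
    using that by (simp add: star_ip ip_self)
  have "(\<Sum>i\<in>I. ip H ((star A T \<otimes>\<^bsub>A\<^esub> T) i \<xi>) \<xi>) / of_nat (card I)
      = of_real ((\<Sum>i\<in>I. (hnorm H (T i \<xi>))\<^sup>2) / of_nat (card I))"
    if "T \<in> commutant_carrier I H (F ` L)" for T
    using pos that by simp
  then have "(\<Sum>i\<in>I. ip H ((star A T \<otimes>\<^bsub>A\<^esub> T) i \<xi>) \<xi>) / of_nat (card I) \<in> \<real>\<^sub>\<ge>\<^sub>0"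
    if "T \<in> commutant_carrier I H (F ` L)" for T
    using that by (simp only: nonneg_Reals_of_real_iff) (simp add: sum_nonneg)
  moreover have "ip H \<xi> \<xi> = 1" using \<xi> by (simp add: ip_self)
  moreover have "(\<Sum>i\<in>I. ip H ((T \<otimes>\<^bsub>A\<^esub> S) i \<xi>) \<xi>) = (\<Sum>i\<in>I. ip H ((S \<otimes>\<^bsub>A\<^esub> T) i \<xi>) \<xi>)"
    if "T \<in> commutant_carrier I H (F ` L)" "S \<in> commutant_carrier I H (F ` L)" for T S
    using that trace[OF component_in_commutant component_in_commutant] by (intro sum.cong) auto
  ultimately show ?thesis
    unfolding tracial_state_def cstar_state_def using I
    by (simp add: ip_simps sum.distrib add_divide_distrib flip: sum_distrib_left)
qed

text \<open>A member \<open>T\<close> of the commutant is determined by the vector \<open>T \<xi>\<close>, because \<open>\<xi>\<close> is separating, and this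
  vector by its inner products with the countably many vectors \<open>foldr E u \<xi>\<close>.\<close>

lemma carrier_lepoll_reals:
  assumes L: "countable L"
  shows "commutant_carrier I H (F ` L) \<lesssim> (UNIV :: real set)"
proof -
  define \<phi> :: "(nat \<Rightarrow> 'a \<Rightarrow> 'a) \<Rightarrow> nat \<Rightarrow> nat \<Rightarrow> complex" where
    "\<phi> T i k = (if i \<in> I then ip H (T i \<xi>) (foldr E (from_nat_into (lists L) k) \<xi>) else 0)" for T i k
  have word: "foldr E u \<xi> \<in> carrier H" if "u \<in> lists L" for u
    using that by (induction u) auto
  have "inj_on \<phi> (commutant_carrier I H (F ` L))"
  proof (rule inj_onI)
    fix T S assume T: "T \<in> commutant_carrier I H (F ` L)" and S: "S \<in> commutant_carrier I H (F ` L)"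
      and eq: "\<phi> T = \<phi> S"
    have D: "T \<ominus>\<^bsub>A\<^esub> S \<in> commutant_carrier I H (F ` L)" by (rule minus_mem[OF T S])
    show "T = S"
    proof (rule eqI[OF T S])
      fix i x assume i: "i \<in> I" and x: "x \<in> carrier H"
      have "(T \<ominus>\<^bsub>A\<^esub> S) i \<xi> = \<zero>\<^bsub>H\<^esub>"
      proof (rule orthogonal_to_words)
        fix u assume u: "u \<in> lists L"
        obtain k where k: "u = from_nat_into (lists L) k"
          using from_nat_into_surj[OF countable_lists[OF L] u] by metis
        have "\<phi> T i k = \<phi> S i k" using eq by simp
        then show "ip H ((T \<ominus>\<^bsub>A\<^esub> S) i \<xi>) (foldr E u \<xi>) = 0"
          using i T S word[OF u] by (simp add: \<phi>_def A_minus_apply ip_simps flip: k)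
      qed (use D i in auto)
      then have "(T \<ominus>\<^bsub>A\<^esub> S) i x = \<zero>\<^bsub>H\<^esub>"
        by (rule separating[OF component_in_commutant[OF D i] _ x])
      then show "T i x = S i x"
        using A_minus_apply[OF T S i x] minus_eq_0_iff T S i x by simp
    qed
  qed
  then have "commutant_carrier I H (F ` L) \<lesssim> (UNIV :: (nat \<Rightarrow> nat \<Rightarrow> complex) set)"
    unfolding lepoll_def by blast
  then show ?thesis using complex_sequences_lepoll_reals lepoll_trans by blast
qed

lemma restrict_E_in_commutant:
  assumes a: "\<And>i. i \<in> I \<Longrightarrow> a i \<in> L"
  shows "(\<lambda>i\<in>I. restrict (E (a i)) (carrier H)) \<in> commutant_carrier I H (F ` L)"
proof (rule memI[where B = 1 and S = "\<lambda>i. E (a i)"])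
  fix i assume i: "i \<in> I"
  note ai = a[OF i]
  show "adjoint_ops H ((\<lambda>i\<in>I. restrict (E (a i)) (carrier H)) i) (E (a i))"
    using adjoint_opsD(3)[OF E_sa[OF ai]] i ai by (intro adjoint_opsI) simp_all
  show "hnorm H ((\<lambda>i\<in>I. restrict (E (a i)) (carrier H)) i x) \<le> 1 * hnorm H x"
    if "x \<in> carrier H" for x
    using that i ai E_contraction by simp
  show "(\<lambda>i\<in>I. restrict (E (a i)) (carrier H)) i (f x) = f ((\<lambda>i\<in>I. restrict (E (a i)) (carrier H)) i x)"
    if "f \<in> F ` L" "x \<in> carrier H" for f x
    using that i ai EF_commute by auto
qed simp_all

lemma star_restrict_E:
  assumes a: "\<And>i. i \<in> I \<Longrightarrow> a i \<in> L"
  shows "star A (\<lambda>i\<in>I. restrict (E (a i)) (carrier H)) = (\<lambda>i\<in>I. restrict (E (a i)) (carrier H))"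
  by (rule star_eqI) (use restrict_E_in_commutant[OF a] adjoint_opsD(3)[OF E_sa] a in auto)

end

lemma E_idempotent:
  assumes a: "a \<in> L" and 0: "E a (E a \<xi>) = E a \<xi>" and x: "x \<in> carrier H"
  shows "E a (E a x) = E a x"
proof -
  note c = in_commutant_E[OF a]
  have minus: "y \<oplus>\<^bsub>H\<^esub> (-1) \<odot>\<^bsub>H\<^esub> z = \<zero>\<^bsub>H\<^esub> \<longleftrightarrow> y = z" if "y \<in> carrier H" "z \<in> carrier H" for y z
  proof -
    have "y \<oplus>\<^bsub>H\<^esub> (-1) \<odot>\<^bsub>H\<^esub> z = y \<ominus>\<^bsub>H\<^esub> z"
      by (rule eqI_ip) (use that in \<open>auto simp: ip_simps\<close>)
    then show ?thesis using minus_eq_0_iff that by simp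
  qed
  have "E a (E a x) \<oplus>\<^bsub>H\<^esub> (-1) \<odot>\<^bsub>H\<^esub> E a x = \<zero>\<^bsub>H\<^esub>"
    by (rule separating[OF in_commutant_add[OF in_commutant_comp[OF c c] in_commutant_smult[OF c]] _ x])
       (use a 0 in \<open>simp add: minus\<close>)
  then show ?thesis using minus a x by simp
qed

lemma E_orthogonal:
  assumes "a \<in> L" "b \<in> L" "E a (E b \<xi>) = \<zero>\<^bsub>H\<^esub>" "x \<in> carrier H"
  shows "E a (E b x) = \<zero>\<^bsub>H\<^esub>"
  by (rule separating[OF in_commutant_comp[OF in_commutant_E in_commutant_E] _ assms(4)])
     (use assms in auto)

end

section \<open>Restriction to the cyclic subspace\<close>

lemma op_poly_carrier_update: "op_poly H L E Q Q' \<Longrightarrow> op_poly (H\<lparr>carrier := K\<rparr>) L E Q Q'"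
proof (induction rule: op_poly.induct)
  case (add Q Q' R R')
  then show ?case using op_poly.add[of "H\<lparr>carrier := K\<rparr>" L E Q Q' R R'] by simp
next
  case (smult Q Q' c)
  then show ?case using op_poly.smult[of "H\<lparr>carrier := K\<rparr>" L E Q Q' c] by simp
qed (auto intro: op_poly.unit op_poly.mult)

lemma hnorm_carrier_update [simp]: "hnorm (H\<lparr>carrier := K\<rparr>) x = hnorm H x"
  by (simp add: hnorm_def)

context hilbert_space
begin

lemma minus_carrier_update:
  assumes ab: "abelian_group (H\<lparr>carrier := K\<rparr>)" and sub: "K \<subseteq> carrier H" and "x \<in> K" and y: "y \<in> K"
  shows "x \<ominus>\<^bsub>H\<lparr>carrier := K\<rparr>\<^esub> y = x \<ominus>\<^bsub>H\<^esub> y"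
proof -
  let ?K = "H\<lparr>carrier := K\<rparr>"
  interpret K: abelian_group ?K by (rule ab)
  have "\<ominus>\<^bsub>?K\<^esub> y \<in> K" "\<ominus>\<^bsub>?K\<^esub> y \<oplus>\<^bsub>H\<^esub> y = \<zero>\<^bsub>H\<^esub>"
    using K.a_inv_closed[of y] K.l_neg[of y] y by simp_all
  then have "\<ominus>\<^bsub>H\<^esub> y = \<ominus>\<^bsub>?K\<^esub> y"
    using sub y by (intro M.minus_equality) auto
  then show ?thesis by (simp add: a_minus_def)
qed

text \<open>The condition \<open>closed\<close> is stated with approximating vectors, the form in which it is
  available for closures.\<close>

lemma closed_subspace:
  assumes sub: "K \<subseteq> carrier H" and zero: "\<zero>\<^bsub>H\<^esub> \<in> K"
    and add: "\<And>x y. \<lbrakk>x \<in> K; y \<in> K\<rbrakk> \<Longrightarrow> x \<oplus>\<^bsub>H\<^esub> y \<in> K"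
    and smult: "\<And>c x. x \<in> K \<Longrightarrow> c \<odot>\<^bsub>H\<^esub> x \<in> K"
    and closed: "\<And>x. \<lbrakk>x \<in> carrier H; \<And>\<epsilon>. 0 < \<epsilon> \<Longrightarrow> \<exists>y\<in>K. hnorm H (x \<ominus>\<^bsub>H\<^esub> y) < \<epsilon>\<rbrakk> \<Longrightarrow> x \<in> K"
  shows "hilbert_space (H\<lparr>carrier := K\<rparr>)"
proof -
  let ?K = "H\<lparr>carrier := K\<rparr>"
  have mem: "x \<in> carrier H" if "x \<in> K" for x using that sub by blast
  have ab: "abelian_group ?K"
  proof (rule abelian_groupI)
    fix x assume "x \<in> carrier ?K"
    then have x: "x \<in> K" by simp
    have "(-1) \<odot>\<^bsub>H\<^esub> x \<oplus>\<^bsub>H\<^esub> x = \<zero>\<^bsub>H\<^esub>"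
      by (rule eqI_ip) (use mem[OF x] in \<open>auto simp: ip_simps\<close>)
    then show "\<exists>y\<in>carrier ?K. y \<oplus>\<^bsub>?K\<^esub> x = \<zero>\<^bsub>?K\<^esub>"
      using smult[OF x] by auto
  qed (use zero add mem in \<open>auto simp: M.add.m_ac\<close>)
  note minus = minus_carrier_update[OF ab sub]
  show "hilbert_space ?K"
  proof (intro hilbert_space.intro hilbert_space_axioms.intro)
    show "module complex_ring ?K"
      by (rule moduleI[OF cring_complex_ring ab])
         (use smult mem in \<open>auto simp: complex_smult smult_r_distr\<close>)
    show "seq_complete_on (carrier ?K) (\<lambda>x y. hnorm ?K (x \<ominus>\<^bsub>?K\<^esub> y))"
      unfolding seq_complete_on_def
    proof (intro allI impI)
      fix X :: "nat \<Rightarrow> 'a"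
      assume "\<forall>n. X n \<in> carrier ?K"
      then have X: "X n \<in> K" for n by simp
      assume "\<forall>\<epsilon>>0. \<exists>N. \<forall>m\<ge>N. \<forall>n\<ge>N. hnorm ?K (X m \<ominus>\<^bsub>?K\<^esub> X n) < \<epsilon>"
      then have "\<forall>\<epsilon>>0. \<exists>N. \<forall>m\<ge>N. \<forall>n\<ge>N. hnorm H (X m \<ominus>\<^bsub>H\<^esub> X n) < \<epsilon>"
        using X by (simp add: minus)
      then obtain x where x: "x \<in> carrier H" and lim: "(\<lambda>n. hnorm H (X n \<ominus>\<^bsub>H\<^esub> x)) \<longlonglongrightarrow> 0"
        using hnorm_complete mem[OF X] unfolding seq_complete_on_def by blast
      have "x \<in> K"
      proof (rule closed[OF x])
        fix \<epsilon> :: real assume "0 < \<epsilon>"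
        then have "\<forall>\<^sub>F n in sequentially. hnorm H (X n \<ominus>\<^bsub>H\<^esub> x) < \<epsilon>"
          by (rule order_tendstoD(2)[OF lim])
        then obtain n where "hnorm H (X n \<ominus>\<^bsub>H\<^esub> x) < \<epsilon>"
          by (auto simp: eventually_sequentially)
        then show "\<exists>y\<in>K. hnorm H (x \<ominus>\<^bsub>H\<^esub> y) < \<epsilon>"
          using X hnorm_minus_commute[OF mem[OF X] x] by auto
      qed
      then show "\<exists>x\<in>carrier ?K. (\<lambda>n. hnorm ?K (X n \<ominus>\<^bsub>?K\<^esub> x)) \<longlonglongrightarrow> 0"
        using lim X by (auto intro!: bexI[of _ x] simp: minus)
    qed
  qed (use mem in \<open>auto simp: ip_add_left ip_smult_left intro: ip_commute ip_nonneg ip_eq_0\<close>)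
qed

end

context mirrored_pair
begin

definition cyclic_subspace :: "'a set" where
  "cyclic_subspace = {x \<in> carrier H. \<forall>\<epsilon>>0. \<exists>Q Q'. poly Q Q' \<and> hnorm H (x \<ominus>\<^bsub>H\<^esub> Q \<xi>) < \<epsilon>}"

lemma cyclic_subspaceI:
  assumes "x \<in> carrier H" "\<And>\<epsilon>. 0 < \<epsilon> \<Longrightarrow> \<exists>Q Q'. poly Q Q' \<and> hnorm H (x \<ominus>\<^bsub>H\<^esub> Q \<xi>) < \<epsilon>"
  shows "x \<in> cyclic_subspace"
  using assms by (simp add: cyclic_subspace_def)

lemma cyclic_subspaceD:
  assumes "x \<in> cyclic_subspace"
  shows "x \<in> carrier H"
    and "0 < \<epsilon> \<Longrightarrow> \<exists>Q Q'. poly Q Q' \<and> hnorm H (x \<ominus>\<^bsub>H\<^esub> Q \<xi>) < \<epsilon>"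
  using assms by (auto simp: cyclic_subspace_def)

lemma poly_in_cyclic_subspace: "poly Q Q' \<Longrightarrow> Q \<xi> \<in> cyclic_subspace"
proof (rule cyclic_subspaceI)
  fix \<epsilon> :: real assume Q: "poly Q Q'" and "0 < \<epsilon>"
  have "Q \<xi> \<ominus>\<^bsub>H\<^esub> Q \<xi> = \<zero>\<^bsub>H\<^esub>" using minus_eq_0_iff Q by simp
  then show "\<exists>R R'. poly R R' \<and> hnorm H (Q \<xi> \<ominus>\<^bsub>H\<^esub> R \<xi>) < \<epsilon>"
    using Q \<open>0 < \<epsilon>\<close> by (intro exI[of _ Q] exI[of _ Q']) simp
qed simp

text \<open>A contraction carries an approximation of \<open>x\<close> by a polynomial vector to one of \<open>T x\<close>.\<close>

lemma contraction_cyclic_subspace: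
  assumes T: "adjoint_ops H T S" and le: "\<And>x. x \<in> carrier H \<Longrightarrow> hnorm H (T x) \<le> hnorm H x"
    and inv: "\<And>Q Q'. poly Q Q' \<Longrightarrow> \<exists>R R'. poly R R' \<and> R \<xi> = T (Q \<xi>)"
    and x: "x \<in> cyclic_subspace"
  shows "T x \<in> cyclic_subspace"
proof (rule cyclic_subspaceI)
  note xc = cyclic_subspaceD(1)[OF x]
  show "T x \<in> carrier H" using adjoint_opsD(1)[OF T xc] .
  fix \<epsilon> :: real assume "0 < \<epsilon>"
  then obtain Q Q' where Q: "poly Q Q'" "hnorm H (x \<ominus>\<^bsub>H\<^esub> Q \<xi>) < \<epsilon>"
    using cyclic_subspaceD(2)[OF x] by blast
  obtain R R' where R: "poly R R'" "R \<xi> = T (Q \<xi>)" using inv[OF Q(1)] by blast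
  have "hnorm H (T x \<ominus>\<^bsub>H\<^esub> R \<xi>) = hnorm H (T (x \<ominus>\<^bsub>H\<^esub> Q \<xi>))"
    using R(2) adjoint_ops_linear(4)[OF T xc, of "Q \<xi>"] Q(1) by simp
  also have "\<dots> \<le> hnorm H (x \<ominus>\<^bsub>H\<^esub> Q \<xi>)" using le xc Q(1) by simp
  finally show "\<exists>Q Q'. poly Q Q' \<and> hnorm H (T x \<ominus>\<^bsub>H\<^esub> Q \<xi>) < \<epsilon>"
    using Q(2) R(1) by force
qed

lemma E_cyclic_subspace: "a \<in> L \<Longrightarrow> x \<in> cyclic_subspace \<Longrightarrow> E a x \<in> cyclic_subspace"
  by (rule contraction_cyclic_subspace[OF E_sa])
     (use E_contraction poly_left_mult in \<open>auto, metis xi_closed\<close>)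

text \<open>\<open>F a (Q \<xi>) = Q (F a \<xi>) = Q (E a \<xi>)\<close> is again a polynomial vector, even though \<open>F a\<close> is not among the
  operators that generate the subspace.\<close>

lemma F_cyclic_subspace: "a \<in> L \<Longrightarrow> x \<in> cyclic_subspace \<Longrightarrow> F a x \<in> cyclic_subspace"
proof (rule contraction_cyclic_subspace[OF F_sa])
  fix Q Q' assume a: "a \<in> L" and Q: "poly Q Q'"
  have "F a (Q \<xi>) = Q (E a \<xi>)" using a Q by (simp add: mirror poly_commute_F)
  then show "\<exists>R R'. poly R R' \<and> R \<xi> = F a (Q \<xi>)" using op_poly.mult[OF Q a] by auto
qed (use F_contraction in auto)

lemma cyclic_mirrored_pair_restrict:
  "cyclic_mirrored_pair (H\<lparr>carrier := cyclic_subspace\<rparr>) L E F \<xi>"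
proof -
  let ?K = "H\<lparr>carrier := cyclic_subspace\<rparr>"
  have mem: "x \<in> carrier H" if "x \<in> cyclic_subspace" for x
    by (rule cyclic_subspaceD(1)[OF that])
  have poly0: "poly (\<lambda>x. 0 \<odot>\<^bsub>H\<^esub> x) (\<lambda>x. cnj 0 \<odot>\<^bsub>H\<^esub> x)" by (rule op_poly.smult[OF op_poly.unit])
  have "0 \<odot>\<^bsub>H\<^esub> \<xi> = \<zero>\<^bsub>H\<^esub>" by (rule eqI_ip) (auto simp: ip_simps)
  then have zero: "\<zero>\<^bsub>H\<^esub> \<in> cyclic_subspace" using poly_in_cyclic_subspace[OF poly0] by simp
  have add: "x \<oplus>\<^bsub>H\<^esub> y \<in> cyclic_subspace" if x: "x \<in> cyclic_subspace" and y: "y \<in> cyclic_subspace" for x y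
  proof (rule cyclic_subspaceI)
    show "x \<oplus>\<^bsub>H\<^esub> y \<in> carrier H" using mem[OF x] mem[OF y] by simp
    fix \<epsilon> :: real assume e: "0 < \<epsilon>"
    obtain Q Q' where Q: "poly Q Q'" "hnorm H (x \<ominus>\<^bsub>H\<^esub> Q \<xi>) < \<epsilon> / 2"
      using cyclic_subspaceD(2)[OF x, of "\<epsilon> / 2"] e by auto
    obtain R R' where R: "poly R R'" "hnorm H (y \<ominus>\<^bsub>H\<^esub> R \<xi>) < \<epsilon> / 2"
      using cyclic_subspaceD(2)[OF y, of "\<epsilon> / 2"] e by auto
    have "(x \<oplus>\<^bsub>H\<^esub> y) \<ominus>\<^bsub>H\<^esub> (Q \<xi> \<oplus>\<^bsub>H\<^esub> R \<xi>) = (x \<ominus>\<^bsub>H\<^esub> Q \<xi>) \<oplus>\<^bsub>H\<^esub> (y \<ominus>\<^bsub>H\<^esub> R \<xi>)"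
      by (rule eqI_ip) (use mem[OF x] mem[OF y] Q(1) R(1) in \<open>auto simp: ip_simps\<close>)
    then have "hnorm H ((x \<oplus>\<^bsub>H\<^esub> y) \<ominus>\<^bsub>H\<^esub> (Q \<xi> \<oplus>\<^bsub>H\<^esub> R \<xi>)) < \<epsilon>"
      using hnorm_add[of "x \<ominus>\<^bsub>H\<^esub> Q \<xi>" "y \<ominus>\<^bsub>H\<^esub> R \<xi>"] mem[OF x] mem[OF y] Q R by simp
    then show "\<exists>Q Q'. poly Q Q' \<and> hnorm H (x \<oplus>\<^bsub>H\<^esub> y \<ominus>\<^bsub>H\<^esub> Q \<xi>) < \<epsilon>"
      using op_poly.add[OF Q(1) R(1)] by blast
  qed
  have smult: "c \<odot>\<^bsub>H\<^esub> x \<in> cyclic_subspace" if x: "x \<in> cyclic_subspace" for c x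
  proof (rule cyclic_subspaceI)
    show "c \<odot>\<^bsub>H\<^esub> x \<in> carrier H" using mem[OF x] by simp
    fix \<epsilon> :: real assume e: "0 < \<epsilon>"
    have c1: "cmod c + 1 > 0" by (simp add: add_nonneg_pos)
    obtain Q Q' where Q: "poly Q Q'" "hnorm H (x \<ominus>\<^bsub>H\<^esub> Q \<xi>) < \<epsilon> / (cmod c + 1)"
      using cyclic_subspaceD(2)[OF x, of "\<epsilon> / (cmod c + 1)"] e c1 by auto
    have "c \<odot>\<^bsub>H\<^esub> x \<ominus>\<^bsub>H\<^esub> c \<odot>\<^bsub>H\<^esub> Q \<xi> = c \<odot>\<^bsub>H\<^esub> (x \<ominus>\<^bsub>H\<^esub> Q \<xi>)"
      by (rule eqI_ip) (use mem[OF x] Q(1) in \<open>auto simp: ip_simps algebra_simps\<close>)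
    then have "hnorm H (c \<odot>\<^bsub>H\<^esub> x \<ominus>\<^bsub>H\<^esub> c \<odot>\<^bsub>H\<^esub> Q \<xi>) = cmod c * hnorm H (x \<ominus>\<^bsub>H\<^esub> Q \<xi>)"
      using mem[OF x] Q(1) by (simp add: hnorm_smult)
    also have "\<dots> \<le> (cmod c + 1) * hnorm H (x \<ominus>\<^bsub>H\<^esub> Q \<xi>)"
      using mem[OF x] Q(1) by (intro mult_right_mono) auto
    also have "\<dots> < \<epsilon>" using Q(2) c1 by (simp add: field_simps)
    finally show "\<exists>Q Q'. poly Q Q' \<and> hnorm H (c \<odot>\<^bsub>H\<^esub> x \<ominus>\<^bsub>H\<^esub> Q \<xi>) < \<epsilon>"
      using op_poly.smult[OF Q(1), of c] by blast
  qed
  have closed: "x \<in> cyclic_subspace"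
    if x: "x \<in> carrier H" and lim: "\<And>\<epsilon>. 0 < \<epsilon> \<Longrightarrow> \<exists>y\<in>cyclic_subspace. hnorm H (x \<ominus>\<^bsub>H\<^esub> y) < \<epsilon>" for x
  proof (rule cyclic_subspaceI[OF x])
    fix \<epsilon> :: real assume e: "0 < \<epsilon>"
    obtain y where y: "y \<in> cyclic_subspace" "hnorm H (x \<ominus>\<^bsub>H\<^esub> y) < \<epsilon> / 2"
      using lim[of "\<epsilon> / 2"] e by auto
    obtain Q Q' where Q: "poly Q Q'" "hnorm H (y \<ominus>\<^bsub>H\<^esub> Q \<xi>) < \<epsilon> / 2"
      using cyclic_subspaceD(2)[OF y(1), of "\<epsilon> / 2"] e by auto
    have "hnorm H (x \<ominus>\<^bsub>H\<^esub> Q \<xi>) < \<epsilon>"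
      using hnorm_triangle[OF x mem[OF y(1)], of "Q \<xi>"] Q y(2) by simp
    then show "\<exists>Q Q'. poly Q Q' \<and> hnorm H (x \<ominus>\<^bsub>H\<^esub> Q \<xi>) < \<epsilon>" using Q(1) by blast
  qed
  have sub: "cyclic_subspace \<subseteq> carrier H" using mem by blast
  have hilbert: "hilbert_space ?K" by (rule closed_subspace[OF sub zero add smult closed])
  then have ab: "abelian_group ?K" by (simp add: hilbert_space_def Module.module_def)
  have xi: "\<xi> \<in> cyclic_subspace" by (rule poly_in_cyclic_subspace[OF op_poly.unit])
  show ?thesis
  proof (intro cyclic_mirrored_pair.intro mirrored_pair.intro mirrored_pair_axioms.intro
      cyclic_mirrored_pair_axioms.intro)
    show "hilbert_space ?K" by (rule hilbert)
    show "\<exists>Q Q'. op_poly ?K L E Q Q' \<and> hnorm ?K (x \<ominus>\<^bsub>?K\<^esub> Q \<xi>) < \<epsilon>"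
      if x: "x \<in> carrier ?K" and e: "0 < \<epsilon>" for x \<epsilon>
    proof -
      have x: "x \<in> cyclic_subspace" using x by simp
      from cyclic_subspaceD(2)[OF x e] obtain Q Q' where
        Q: "poly Q Q'" "hnorm H (x \<ominus>\<^bsub>H\<^esub> Q \<xi>) < \<epsilon>" by blast
      then have "hnorm ?K (x \<ominus>\<^bsub>?K\<^esub> Q \<xi>) < \<epsilon>"
        using minus_carrier_update[OF ab sub x poly_in_cyclic_subspace[OF Q(1)]] by simp
      then show ?thesis using op_poly_carrier_update[OF Q(1)] by blast
    qed
    show "adjoint_ops ?K (E a) (E a)" "adjoint_ops ?K (F a) (F a)" if "a \<in> L" for a
      using that E_cyclic_subspace F_cyclic_subspace adjoint_opsD(3)[OF E_sa] adjoint_opsD(3)[OF F_sa] mem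
      by (auto simp: adjoint_ops_def)
  qed (use mem E_contraction F_contraction EF_commute xi mirror in auto)
qed

end

section \<open>Synchronous correlations\<close>

context hilbert_space
begin

lemma positive_operatorD:
  assumes "positive_operator H T"
  shows "x \<in> carrier H \<Longrightarrow> T x \<in> carrier H"
    "\<lbrakk>x \<in> carrier H; y \<in> carrier H\<rbrakk> \<Longrightarrow> T (x \<oplus>\<^bsub>H\<^esub> y) = T x \<oplus>\<^bsub>H\<^esub> T y"
    "x \<in> carrier H \<Longrightarrow> T (c \<odot>\<^bsub>H\<^esub> x) = c \<odot>\<^bsub>H\<^esub> T x"
    "x \<in> carrier H \<Longrightarrow> 0 \<le> Re (ip H (T x) x)"
    "x \<in> carrier H \<Longrightarrow> Im (ip H (T x) x) = 0"
  using assms by (auto simp: positive_operator_def bounded_operator_def nonneg_Reals_complex_iff)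

text \<open>A real quadratic form makes the form \<open>\<langle>T x, y\<rangle> - \<langle>x, T y\<rangle>\<close> vanish on the diagonal; polarisation with
  \<open>x + y\<close> and \<open>x + \<i> y\<close> does the rest.\<close>

lemma positive_operator_self_adjoint:
  assumes T: "positive_operator H T" shows "adjoint_ops H T T"
proof (rule adjoint_opsI)
  note D = positive_operatorD[OF T]
  have diag: "ip H (T z) z = ip H z (T z)" if "z \<in> carrier H" for z
    using ip_commute[of z "T z"] D[of z] that by (simp add: complex_eq_iff)
  fix x y assume x: "x \<in> carrier H" and y: "y \<in> carrier H"
  have "(ip H (T x) y - ip H x (T y)) + (ip H (T y) x - ip H y (T x)) = 0"
    using diag[of "x \<oplus>\<^bsub>H\<^esub> y"] diag[OF x] diag[OF y] x y D by (simp add: ip_simps algebra_simps)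
  moreover have "(ip H (T x) y - ip H x (T y)) - (ip H (T y) x - ip H y (T x)) = 0"
    using diag[of "x \<oplus>\<^bsub>H\<^esub> \<i> \<odot>\<^bsub>H\<^esub> y"] diag[OF x] diag[OF y] x y D
    by (simp add: ip_simps algebra_simps complex_eq_iff)
  ultimately show "ip H (T x) y = ip H x (T y)" by (simp add: complex_eq_iff)
qed (use positive_operatorD[OF T] in auto)

text \<open>At \<open>x - t T x\<close> the quadratic form has the value \<open>- 2 t \<parallel>T x\<parallel>\<^sup>2 + O(t\<^sup>2)\<close>, which is negative for small
  \<open>t > 0\<close> unless \<open>T x = 0\<close>.\<close>

lemma positive_kernel:
  assumes T: "adjoint_ops H T T" and pos: "\<And>z. z \<in> carrier H \<Longrightarrow> 0 \<le> Re (ip H (T z) z)"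
    and x: "x \<in> carrier H" and 0: "Re (ip H (T x) x) = 0"
  shows "T x = \<zero>\<^bsub>H\<^esub>"
proof -
  note D = adjoint_opsD[OF T]
  define y where "y = T x"
  define n where "n = (hnorm H y)\<^sup>2"
  define b where "b = Re (ip H (T y) y)"
  \<comment> \<open>Small enough that \<open>t * b \<le> n\<close>.\<close>
  define t where "t = n / (b + 1)"
  have y: "y \<in> carrier H" using D x by (simp add: y_def)
  have b: "b \<ge> 0" unfolding b_def by (rule pos[OF y])
  let ?z = "x \<ominus>\<^bsub>H\<^esub> of_real t \<odot>\<^bsub>H\<^esub> y"
  have Tz: "T ?z = y \<ominus>\<^bsub>H\<^esub> of_real t \<odot>\<^bsub>H\<^esub> T y"
    using adjoint_ops_linear[OF T] x y by (simp add: y_def)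
  have n: "ip H y y = of_real n" using y by (simp add: n_def ip_self)
  have "Re (ip H (T y) x) = n"
    using D(3)[OF y x] n by (simp add: y_def)
  moreover have "Re (ip H y x) = 0" using 0 by (simp add: y_def)
  ultimately have "Re (ip H (T ?z) ?z) = t * (t * b) - 2 * t * n"
    unfolding Tz using x y D(1)[OF y] n by (simp add: ip_simps b_def algebra_simps)
  then have "0 \<le> t * (t * b - 2 * n)" using pos[of ?z] x y by (simp add: algebra_simps)
  have "n = 0"
  proof (rule ccontr)
    assume "n \<noteq> 0"
    then have n0: "n > 0" by (simp add: n_def)
    then have t: "t > 0" using b by (simp add: t_def)
    with \<open>0 \<le> t * (t * b - 2 * n)\<close> have "2 * n \<le> t * b"
      by (simp add: zero_le_mult_iff)
    also have "t * b \<le> n" using n0 b by (simp add: t_def field_simps)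
    finally show False using n0 by simp
  qed
  then show ?thesis using y by (simp add: n_def y_def)
qed

text \<open>For \<open>0 \<le> T \<le> 1\<close> this is \<open>T - T\<^sup>2 = (1 - T) T (1 - T) + T (1 - T) T \<ge> 0\<close>.\<close>

lemma positive_contraction:
  assumes T: "adjoint_ops H T T" and pos: "\<And>z. z \<in> carrier H \<Longrightarrow> 0 \<le> Re (ip H (T z) z)"
    and le: "\<And>z. z \<in> carrier H \<Longrightarrow> Re (ip H (T z) z) \<le> (hnorm H z)\<^sup>2"
    and x: "x \<in> carrier H"
  shows "(hnorm H (T x))\<^sup>2 \<le> Re (ip H (T x) x)"
proof -
  note D = adjoint_opsD[OF T]
  have cl: "T x \<in> carrier H" "T (T x) \<in> carrier H" using D x by auto
  have "0 \<le> Re (ip H (T (x \<ominus>\<^bsub>H\<^esub> T x)) (x \<ominus>\<^bsub>H\<^esub> T x)) + ((hnorm H (T x))\<^sup>2 - Re (ip H (T (T x)) (T x)))"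
    using pos[of "x \<ominus>\<^bsub>H\<^esub> T x"] le[of "T x"] x cl by simp
  also have "\<dots> = Re (ip H (T x) x) - (hnorm H (T x))\<^sup>2"
    using x cl D(3)[OF cl(1) x] D(3)[OF x cl(1)]
    by (simp add: adjoint_ops_linear(4)[OF T] ip_simps hnorm_sq)
  finally show ?thesis by simp
qed

lemma partition_le:
  assumes J: "finite J" and pos: "\<And>j. j \<in> J \<Longrightarrow> positive_operator H (P j)"
    and sum: "(\<Oplus>\<^bsub>H\<^esub>j\<in>J. P j x) = x" and i: "i \<in> J" and x: "x \<in> carrier H"
  shows "Re (ip H (P i x) x) \<le> (hnorm H x)\<^sup>2"
proof -
  have "(hnorm H x)\<^sup>2 = Re (ip H (\<Oplus>\<^bsub>H\<^esub>j\<in>J. P j x) x)" by (simp add: sum hnorm_sq x)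
  also have "\<dots> = (\<Sum>j\<in>J. Re (ip H (P j x) x))"
    using J pos x positive_operatorD(1) by (subst ip_finsum_left) auto
  also have "\<dots> \<ge> Re (ip H (P i x) x)"
    using J pos x positive_operatorD(4) by (intro member_le_sum i) auto
  finally show ?thesis .
qed

lemma partition_contraction:
  assumes J: "finite J" and pos: "\<And>j. j \<in> J \<Longrightarrow> positive_operator H (P j)"
    and sum: "\<And>x. x \<in> carrier H \<Longrightarrow> (\<Oplus>\<^bsub>H\<^esub>j\<in>J. P j x) = x" and i: "i \<in> J" and x: "x \<in> carrier H"
  shows "(hnorm H (P i x))\<^sup>2 \<le> Re (ip H (P i x) x)" and "hnorm H (P i x) \<le> hnorm H x"
proof -
  have le: "Re (ip H (P i z) z) \<le> (hnorm H z)\<^sup>2" if "z \<in> carrier H" for z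
    by (rule partition_le[OF J pos sum[OF that] i that])
  show 1: "(hnorm H (P i x))\<^sup>2 \<le> Re (ip H (P i x) x)"
    by (rule positive_contraction[OF positive_operator_self_adjoint[OF pos[OF i]] _ le x])
       (rule positive_operatorD(4)[OF pos[OF i]])
  show "hnorm H (P i x) \<le> hnorm H x"
    by (rule power2_le_imp_le) (use 1 le[OF x] x in auto)
qed

text \<open>Since \<open>\<Sum>\<^sub>j R j \<xi> = \<xi>\<close> and the mixed terms vanish, \<open>\<langle>P i \<xi>, \<xi>\<rangle>\<close>, \<open>\<langle>R i \<xi>, \<xi>\<rangle>\<close> and \<open>\<langle>P i \<xi>, R i \<xi>\<rangle>\<close> coincide.  With
  \<open>\<parallel>P i \<xi>\<parallel>\<^sup>2 \<le> \<langle>P i \<xi>, \<xi>\<rangle>\<close> and the same for \<open>R i\<close>, expanding \<open>\<parallel>P i \<xi> - R i \<xi>\<parallel>\<^sup>2\<close> leaves at most \<open>0\<close>.\<close>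

lemma synchronous:
  assumes J: "finite J"
    and P: "\<And>j. j \<in> J \<Longrightarrow> positive_operator H (P j)" and R: "\<And>j. j \<in> J \<Longrightarrow> positive_operator H (R j)"
    and sumP: "\<And>x. x \<in> carrier H \<Longrightarrow> (\<Oplus>\<^bsub>H\<^esub>j\<in>J. P j x) = x"
    and sumR: "\<And>x. x \<in> carrier H \<Longrightarrow> (\<Oplus>\<^bsub>H\<^esub>j\<in>J. R j x) = x"
    and \<xi>: "\<xi> \<in> carrier H"
    and comm: "\<And>i j x. \<lbrakk>i \<in> J; j \<in> J; x \<in> carrier H\<rbrakk> \<Longrightarrow> P i (R j x) = R j (P i x)"
    and sync: "\<And>i j. \<lbrakk>i \<in> J; j \<in> J; i \<noteq> j\<rbrakk> \<Longrightarrow> ip H (P i (R j \<xi>)) \<xi> = 0"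
    and i: "i \<in> J"
  shows "P i \<xi> = R i \<xi>" and "P i (P i \<xi>) = P i \<xi>"
proof -
  have Pc [simp]: "P j x \<in> carrier H" and Rc [simp]: "R j x \<in> carrier H"
    if "j \<in> J" "x \<in> carrier H" for j x
    using that positive_operatorD(1) P R by auto
  note [simp] = \<xi> i
  note Psa = positive_operator_self_adjoint[OF P] and Rsa = positive_operator_self_adjoint[OF R]
  have one: "(\<Sum>j\<in>J. ip H (P i (R j \<xi>)) \<xi>) = ip H (P i (R i \<xi>)) \<xi>"
    "(\<Sum>j\<in>J. ip H (P j (R i \<xi>)) \<xi>) = ip H (P i (R i \<xi>)) \<xi>"
    using sync[OF i _ not_sym] sync[OF _ i] by (subst sum.remove[OF J i], subst sum.neutral; simp)+
  have "ip H (P i \<xi>) \<xi> = ip H (\<Oplus>\<^bsub>H\<^esub>j\<in>J. R j \<xi>) (P i \<xi>)"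
    using adjoint_opsD(3)[OF Psa] by (simp add: sumR)
  also have "\<dots> = (\<Sum>j\<in>J. ip H (P i (R j \<xi>)) \<xi>)"
    using J adjoint_opsD(3)[OF Psa[OF i]] by (subst ip_finsum_left) auto
  finally have Pi: "ip H (P i \<xi>) \<xi> = ip H (P i (R i \<xi>)) \<xi>" using one by simp
  have "ip H (R i \<xi>) \<xi> = ip H (\<Oplus>\<^bsub>H\<^esub>j\<in>J. P j (R i \<xi>)) \<xi>" by (simp add: sumP)
  also have "\<dots> = (\<Sum>j\<in>J. ip H (P j (R i \<xi>)) \<xi>)"
    using J by (subst ip_finsum_left) auto
  finally have Ri: "ip H (R i \<xi>) \<xi> = ip H (P i (R i \<xi>)) \<xi>" using one by simp
  define a where "a = Re (ip H (P i (R i \<xi>)) \<xi>)"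
  have leP: "(hnorm H (P i x))\<^sup>2 \<le> Re (ip H (P i x) x)" if "x \<in> carrier H" for x
    by (rule partition_contraction(1)[OF J P sumP i that])
  have leR: "(hnorm H (R i x))\<^sup>2 \<le> Re (ip H (R i x) x)" if "x \<in> carrier H" for x
    by (rule partition_contraction(1)[OF J R sumR i that])
  have PR: "Re (ip H (P i \<xi>) (R i \<xi>)) = a" "Re (ip H (R i \<xi>) (P i \<xi>)) = a"
    using adjoint_opsD(3)[OF Psa[OF i], of "R i \<xi>" \<xi>] ip_commute[of "P i \<xi>" "R i \<xi>"]
    by (simp_all add: a_def)
  have "(hnorm H (P i \<xi> \<ominus>\<^bsub>H\<^esub> R i \<xi>))\<^sup>2 = (hnorm H (P i \<xi>))\<^sup>2 + (hnorm H (R i \<xi>))\<^sup>2 - 2 * a"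
    using PR by (simp add: hnorm_sq ip_simps)
  also have "\<dots> \<le> 0" using leP[OF \<xi>] leR[OF \<xi>] Pi Ri by (simp add: a_def)
  finally have "P i \<xi> \<ominus>\<^bsub>H\<^esub> R i \<xi> = \<zero>\<^bsub>H\<^esub>" by simp
  then show eq: "P i \<xi> = R i \<xi>" using minus_eq_0_iff by simp
  \<comment> \<open>\<open>P i - (P i)\<^sup>2\<close> is positive and its quadratic form vanishes at \<open>\<xi>\<close>.\<close>
  let ?D = "\<lambda>x. P i x \<ominus>\<^bsub>H\<^esub> P i (P i x)"
  have "?D \<xi> = \<zero>\<^bsub>H\<^esub>"
  proof (rule positive_kernel[where T = ?D and x = \<xi>])
    show "adjoint_ops H ?D ?D"
      by (rule adjoint_opsI) (use adjoint_opsD(3)[OF Psa[OF i]] in \<open>auto simp: ip_simps\<close>)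
    show "0 \<le> Re (ip H (?D z) z)" if "z \<in> carrier H" for z
      using leP[OF that] that adjoint_opsD(3)[OF Psa[OF i], of "P i z" z] by (simp add: ip_simps hnorm_sq)
    show "Re (ip H (?D \<xi>) \<xi>) = 0"
      using adjoint_opsD(3)[OF Psa[OF i], of "P i \<xi>" \<xi>] PR Pi by (simp add: ip_simps eq[symmetric] a_def)
  qed simp
  then show "P i (P i \<xi>) = P i \<xi>" using minus_eq_0_iff[of "P i \<xi>" "P i (P i \<xi>)"] by simp
qed

end

text \<open>The letters are the pairs of a vertex and a colour, and the colours also index the components of the direct
  sum.  The projection of a vertex \<open>v\<close> has the operator of \<open>(v, i)\<close> as its \<open>i\<close>-th component.\<close>

lemma qc_colouring_tracial_value:
  fixes G :: "'v pair_pre_digraph"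
  assumes G: "pair_graph G" and U: "(UNIV :: real set) \<lesssim> (UNIV :: 'a set)"
    and c: "0 < c" and col: "qc_colourable TYPE('h) G c"
  shows "1 / real c \<in> tracial_values TYPE('a) G"
proof -
  interpret G: pair_graph G by (rule G)
  define J where "J = {1..c}"
  have J: "finite J" "J \<noteq> {}" "card J = c" using c by (auto simp: J_def)
  from col obtain p where p_mem: "p \<in> C_qc TYPE('h) (pverts G) c"
    and sync: "\<And>v i j. \<lbrakk>v \<in> pverts G; i \<in> J; j \<in> J; i \<noteq> j\<rbrakk> \<Longrightarrow> p i j v v = 0"
    and edge: "\<And>v w i. \<lbrakk>(v, w) \<in> parcs G; i \<in> J\<rbrakk> \<Longrightarrow> p i i v w = 0"
    unfolding qc_colourable_def J_def by fast
  from p_mem[unfolded C_qc_def mem_Collect_eq, folded J_def] obtain H :: "'h hilbert" and E F :: "'v \<Rightarrow> nat \<Rightarrow> 'h \<Rightarrow> 'h" and \<xi> where H: "hilbert_space H"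
    and EF: "\<forall>v\<in>pverts G. \<forall>i\<in>J. positive_operator H (E v i) \<and> positive_operator H (F v i)"
    and sums: "\<forall>v\<in>pverts G. \<forall>x\<in>carrier H. (\<Oplus>\<^bsub>H\<^esub>i\<in>J. E v i x) = x"
      "\<forall>w\<in>pverts G. \<forall>x\<in>carrier H. (\<Oplus>\<^bsub>H\<^esub>j\<in>J. F w j x) = x"
    and commute: "\<forall>v\<in>pverts G. \<forall>w\<in>pverts G. \<forall>i\<in>J. \<forall>j\<in>J. \<forall>x\<in>carrier H. E v i (F w j x) = F w j (E v i x)"
    and \<xi>: "\<xi> \<in> carrier H" "hnorm H \<xi> = 1"
    and vals: "\<forall>v\<in>pverts G. \<forall>w\<in>pverts G. \<forall>i\<in>J. \<forall>j\<in>J.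
      complex_of_real (p i j v w) = ip H (E v i (F w j \<xi>)) \<xi>"
    by (elim exE conjE) (rule that, assumption+)
  have E: "positive_operator H (E v i)" and F: "positive_operator H (F v i)"
    if "v \<in> pverts G" "i \<in> J" for v i using EF that by auto
  have sumE: "(\<Oplus>\<^bsub>H\<^esub>i\<in>J. E v i x) = x" and sumF: "(\<Oplus>\<^bsub>H\<^esub>i\<in>J. F v i x) = x"
    if "v \<in> pverts G" "x \<in> carrier H" for v x using sums that by auto
  have comm: "E v i (F w j x) = F w j (E v i x)"
    if "v \<in> pverts G" "w \<in> pverts G" "i \<in> J" "j \<in> J" "x \<in> carrier H" for v w i j x
    using commute that by blast
  have p: "complex_of_real (p i j v w) = ip H (E v i (F w j \<xi>)) \<xi>"
    if "v \<in> pverts G" "w \<in> pverts G" "i \<in> J" "j \<in> J" for v w i j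
    using vals that by blast
  interpret H: hilbert_space H by (rule H)
  have sync': "ip H (E v i (F v j \<xi>)) \<xi> = 0" if "v \<in> pverts G" "i \<in> J" "j \<in> J" "i \<noteq> j" for v i j
    using p[OF that(1,1,2,3)] sync[OF that] by simp
  have mirror: "E v i \<xi> = F v i \<xi>" and idem: "E v i (E v i \<xi>) = E v i \<xi>"
    if v: "v \<in> pverts G" and i: "i \<in> J" for v i
    by (rule H.synchronous[OF J(1) E[OF v] F[OF v] sumE[OF v] sumF[OF v] \<xi>(1) comm[OF v v] sync'[OF v] i];
        assumption)+
  have contractionE: "(hnorm H (E v i x))\<^sup>2 \<le> Re (ip H (E v i x) x)" "hnorm H (E v i x) \<le> hnorm H x"
    if "v \<in> pverts G" "i \<in> J" "x \<in> carrier H" for v i x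
    by (rule H.partition_contraction[OF J(1) E[OF that(1)] sumE[OF that(1)] that(2,3)]; assumption)+
  have contractionF: "hnorm H (F v i x) \<le> hnorm H x"
    if "v \<in> pverts G" "i \<in> J" "x \<in> carrier H" for v i x
    by (rule H.partition_contraction(2)[OF J(1) F[OF that(1)] sumF[OF that(1)] that(2,3)])
  define L where "L = pverts G \<times> J"
  define E' where "E' a = E (fst a) (snd a)" for a
  define F' where "F' a = F (fst a) (snd a)" for a
  interpret pair: mirrored_pair H L E' F' \<xi>
  proof unfold_locales
    fix a assume "a \<in> L"
    then have a: "fst a \<in> pverts G" "snd a \<in> J" by (auto simp: L_def)
    show "adjoint_ops H (E' a) (E' a)" "adjoint_ops H (F' a) (F' a)"
      using H.positive_operator_self_adjoint E F a by (auto simp: E'_def F'_def)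
    show "E' a \<xi> = F' a \<xi>" using mirror a by (simp add: E'_def F'_def)
    show "hnorm H (E' a x) \<le> hnorm H x" "hnorm H (F' a x) \<le> hnorm H x" if "x \<in> carrier H" for x
      unfolding E'_def F'_def using contractionE(2) contractionF a that by auto
  next
    fix a b x assume "a \<in> L" "b \<in> L" "x \<in> carrier H"
    then show "E' a (F' b x) = F' b (E' a x)" using comm by (auto simp: E'_def F'_def L_def)
  qed (rule \<xi>)
  let ?K = "H\<lparr>carrier := pair.cyclic_subspace\<rparr>"
  interpret K: cyclic_mirrored_pair ?K L E' F' \<xi>
    by (rule pair.cyclic_mirrored_pair_restrict)
  interpret O: operator_commutant ?K J "F' ` L"
    by (rule K.operator_commutant_F)
  have mem: "x \<in> carrier H" if "x \<in> carrier ?K" for x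
    using pair.cyclic_subspaceD(1) that by simp
  define e where "e v = (\<lambda>i\<in>J. restrict (E' (v, i)) (carrier ?K))" for v
  have e_apply: "e v i x = E' (v, i) x" if "i \<in> J" "x \<in> carrier ?K" for v i x
    using that by (simp add: e_def)
  have e_mem: "e v \<in> commutant_carrier J ?K (F' ` L)" if "v \<in> pverts G" for v
    unfolding e_def by (rule K.restrict_E_in_commutant) (use that in \<open>simp add: L_def\<close>)
  show ?thesis
  proof (rule tracial_values_transportI[where A = "commutant_alg J ?K (F' ` L)" and e = e
        and s = "\<lambda>T. (\<Sum>i\<in>J. ip ?K (T i \<xi>) \<xi>) / of_nat (card J)"])
    show "unital_cstar_algebra (commutant_alg J ?K (F' ` L))" by (rule O.cstar_A)
    have "countable L" unfolding L_def using J G.pair_finite_verts by (simp add: countable_finite)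
    then show "carrier (commutant_alg J ?K (F' ` L)) \<lesssim> (UNIV :: 'a set)"
      using K.carrier_lepoll_reals[of J] U lepoll_trans by auto
    show "tracial_state (commutant_alg J ?K (F' ` L)) (\<lambda>T. (\<Sum>i\<in>J. ip ?K (T i \<xi>) \<xi>) / of_nat (card J))"
      by (rule K.tracial_state_A) (use J \<xi> in auto)
    show "parcs G \<subseteq> pverts G \<times> pverts G"
      using G.in_arcsD1 G.in_arcsD2 by auto
  next
    fix v assume v: "v \<in> pverts G"
    show "cstar_projection (commutant_alg J ?K (F' ` L)) (e v)"
      unfolding cstar_projection_def
    proof (intro conjI)
      show "e v \<in> carrier (commutant_alg J ?K (F' ` L))" using e_mem[OF v] by simp
      show "star (commutant_alg J ?K (F' ` L)) (e v) = e v"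
        unfolding e_def by (rule K.star_restrict_E) (use v in \<open>simp add: L_def\<close>)
      show "e v \<otimes>\<^bsub>commutant_alg J ?K (F' ` L)\<^esub> e v = e v"
      proof (rule O.eqI[OF O.mult_mem(1)[OF e_mem[OF v] e_mem[OF v]] e_mem[OF v]])
        fix i x assume i: "i \<in> J" and x: "x \<in> carrier ?K"
        have a: "(v, i) \<in> L" using v i by (simp add: L_def)
        have "E' (v, i) (E' (v, i) \<xi>) = E' (v, i) \<xi>" using idem v i by (simp add: E'_def)
        from K.E_idempotent[OF a this x]
        show "(e v \<otimes>\<^bsub>commutant_alg J ?K (F' ` L)\<^esub> e v) i x = e v i x"
          using O.A_apply(1)[OF i x] e_apply[OF i x] e_apply[OF i K.E_closed[OF a x]] by simp
      qed
    qed
    have "(\<Sum>i\<in>J. ip ?K (e v i \<xi>) \<xi>) = (\<Sum>i\<in>J. ip H (E v i \<xi>) \<xi>)"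
      by (rule sum.cong) (use e_apply K.xi_closed in \<open>auto simp: E'_def\<close>)
    also have "\<dots> = ip H (\<Oplus>\<^bsub>H\<^esub>i\<in>J. E v i \<xi>) \<xi>"
      using J v E H.positive_operatorD(1) \<xi> by (intro H.ip_finsum_left[symmetric]) auto
    also have "\<dots> = 1" using \<xi> v by (simp add: sumE H.ip_self)
    finally show "(\<Sum>i\<in>J. ip ?K (e v i \<xi>) \<xi>) / of_nat (card J) = complex_of_real (1 / real c)"
      using J by simp
  next
    fix v w assume vw: "(v, w) \<in> parcs G"
    have v: "v \<in> pverts G" and w: "w \<in> pverts G"
      using vw G.in_arcsD1 G.in_arcsD2 by auto
    show "e v \<otimes>\<^bsub>commutant_alg J ?K (F' ` L)\<^esub> e w = \<zero>\<^bsub>commutant_alg J ?K (F' ` L)\<^esub>"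
    proof (rule O.eqI[OF O.mult_mem(1)[OF e_mem[OF v] e_mem[OF w]] O.zero_mem])
      fix i x assume i: "i \<in> J" and x: "x \<in> carrier ?K"
      have a: "(v, i) \<in> L" "(w, i) \<in> L" using v w i by (simp_all add: L_def)
      let ?z = "E w i \<xi>"
      have z: "?z \<in> carrier H" using E w i \<xi> H.positive_operatorD(1) by blast
      \<comment> \<open>Both copies of \<open>?z\<close> in \<open>\<langle>E v i ?z, ?z\<rangle>\<close> may be written with \<open>F w i\<close>, and these merge into one by
        idempotency at \<open>\<xi>\<close>; what remains is the correlation \<open>p i i v w\<close>.\<close>
      have Fz: "F w i ?z = ?z"
        using mirror[OF w i] idem[OF w i] comm[OF w w i i \<xi>(1)] by simp
      have "ip H (E v i ?z) ?z = ip H (E v i ?z) (F w i \<xi>)" by (simp add: mirror[OF w i])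
      also have "\<dots> = ip H (F w i (E v i ?z)) \<xi>"
        using H.adjoint_opsD(3)[OF H.positive_operator_self_adjoint[OF F[OF w i]]]
          H.positive_operatorD(1)[OF E[OF v i] z] \<xi> by simp
      also have "\<dots> = ip H (E v i (F w i \<xi>)) \<xi>"
        using comm[OF v w i i z] Fz mirror[OF w i] by simp
      also have "\<dots> = 0" using p[OF v w i i] edge[OF vw i] by simp
      finally have "(hnorm H (E v i ?z))\<^sup>2 \<le> 0"
        using contractionE(1)[OF v i z] by simp
      then have "E v i ?z = \<zero>\<^bsub>H\<^esub>"
        using H.positive_operatorD(1)[OF E[OF v i] z] by simp
      then have "E' (v, i) (E' (w, i) \<xi>) = \<zero>\<^bsub>?K\<^esub>" by (simp add: E'_def)
      from K.E_orthogonal[OF a this x]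
      show "(e v \<otimes>\<^bsub>commutant_alg J ?K (F' ` L)\<^esub> e w) i x = \<zero>\<^bsub>commutant_alg J ?K (F' ` L)\<^esub> i x"
        using O.A_apply(1,3)[OF i x] e_apply[OF i x] e_apply[OF i K.E_closed[OF a(2) x]] by simp
    qed
  qed
qed

section \<open>Existence of a colouring\<close>

text \<open>The one-dimensional Hilbert space, with the carrier \<open>range f\<close>.\<close>

definition complex_line :: "(complex \<Rightarrow> 'h) \<Rightarrow> 'h hilbert" where
  "complex_line f = (let g = inv_into UNIV f in
     \<lparr>carrier = range f, mult = (\<lambda>x y. x), one = f 0, zero = f 0, add = (\<lambda>x y. f (g x + g y)),
      smult = (\<lambda>c x. f (c * g x)), ip = (\<lambda>x y. g x * cnj (g y))\<rparr>)"

context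
  fixes f :: "complex \<Rightarrow> 'h"
  assumes f: "inj f"
begin

lemma complex_line_simps [simp]:
  "carrier (complex_line f) = range f" "\<zero>\<^bsub>complex_line f\<^esub> = f 0"
  "f a \<oplus>\<^bsub>complex_line f\<^esub> f b = f (a + b)" "c \<odot>\<^bsub>complex_line f\<^esub> f a = f (c * a)"
  "ip (complex_line f) (f a) (f b) = a * cnj b"
  using f by (simp_all add: complex_line_def Let_def)

lemma hnorm_complex_line [simp]: "hnorm (complex_line f) (f a) = cmod a"
  by (simp add: hnorm_def complex_norm flip: complex_norm_square)

lemma hilbert_space_complex_line: "hilbert_space (complex_line f)"
proof (intro hilbert_space.intro hilbert_space_axioms.intro)
  let ?H = "complex_line f"
  have ab: "abelian_group ?H"
  proof (rule abelian_groupI)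
    fix x assume "x \<in> carrier ?H"
    then obtain a where "x = f a" by auto
    then show "\<exists>y\<in>carrier ?H. y \<oplus>\<^bsub>?H\<^esub> x = \<zero>\<^bsub>?H\<^esub>"
      by (intro bexI[of _ "f (- a)"]) auto
  qed (auto simp: algebra_simps)
  interpret abelian_group ?H by (rule ab)
  have minus: "f a \<ominus>\<^bsub>?H\<^esub> f b = f (a - b)" for a b
  proof -
    have "\<ominus>\<^bsub>?H\<^esub> f b = f (- b)" by (rule minus_equality) auto
    then show ?thesis by (simp add: a_minus_def)
  qed
  show "module complex_ring ?H"
    by (rule moduleI[OF cring_complex_ring ab]) (auto simp: algebra_simps)
  show "seq_complete_on (carrier ?H) (\<lambda>x y. hnorm ?H (x \<ominus>\<^bsub>?H\<^esub> y))"
    unfolding seq_complete_on_def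
  proof (intro allI impI)
    fix X :: "nat \<Rightarrow> 'h"
    assume "\<forall>n. X n \<in> carrier ?H"
    then have "\<forall>n. \<exists>a. X n = f a" by auto
    then obtain Y where X: "X = (\<lambda>n. f (Y n))" by metis
    assume "\<forall>\<epsilon>>0. \<exists>N. \<forall>m\<ge>N. \<forall>n\<ge>N. hnorm ?H (X m \<ominus>\<^bsub>?H\<^esub> X n) < \<epsilon>"
    then have "Cauchy Y" by (simp add: X minus Cauchy_def dist_norm)
    then obtain a where "Y \<longlonglongrightarrow> a" using Cauchy_convergent convergent_def by blast
    then have "(\<lambda>n. hnorm ?H (X n \<ominus>\<^bsub>?H\<^esub> f a)) \<longlonglongrightarrow> 0"
      by (simp add: X minus tendsto_norm_zero_iff LIM_zero_iff)
    then show "\<exists>x\<in>carrier ?H. (\<lambda>n. hnorm ?H (X n \<ominus>\<^bsub>?H\<^esub> x)) \<longlonglongrightarrow> 0" by auto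
  qed
qed (auto simp: algebra_simps nonneg_Reals_complex_iff)

end

text \<open>The deterministic strategy for an injective colouring of the vertices: every operator is \<open>0\<close> or
  \<open>1\<close>.\<close>

lemma qc_colourable_exists:
  fixes G :: "'v pair_pre_digraph"
  assumes G: "pair_graph G" and U: "(UNIV :: real set) \<lesssim> (UNIV :: 'h set)"
  shows "\<exists>c. qc_colourable TYPE('h) G c"
proof -
  interpret G: pair_graph G by (rule G)
  have "inj (\<lambda>z (i :: nat) (j :: nat). z :: complex)" by (auto simp: inj_def fun_eq_iff)
  then have "(UNIV :: complex set) \<lesssim> (UNIV :: (nat \<Rightarrow> nat \<Rightarrow> complex) set)"
    unfolding lepoll_def by blast
  then have "(UNIV :: complex set) \<lesssim> (UNIV :: 'h set)"
    by (rule lepoll_trans[OF lepoll_trans[OF _ complex_sequences_lepoll_reals] U])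
  then obtain f :: "complex \<Rightarrow> 'h" where f: "inj f"
    unfolding lepoll_def by blast
  let ?H = "complex_line f"
  interpret H: hilbert_space ?H by (rule hilbert_space_complex_line[OF f])
  note [simp] = complex_line_simps[OF f] hnorm_complex_line[OF f]
  define n where "n = card (pverts G)"
  obtain k where k: "bij_betw k (pverts G) {1..n}"
    using ex_bij_betw_nat_finite_1[OF G.pair_finite_verts] bij_betw_inv_into unfolding n_def by blast
  have k_mem: "k v \<in> {1..n}" if "v \<in> pverts G" for v
    using k that by (auto simp: bij_betw_def)
  define P where "P v i x = (if i = k v then x else f 0)" for v i x
  have pos: "positive_operator ?H (P v i)" for v i
    unfolding positive_operator_def bounded_operator_def
    by (auto simp: P_def nonneg_Reals_complex_iff intro!: exI[of _ 1])
  have sum: "(\<Oplus>\<^bsub>?H\<^esub>i\<in>{1..n}. P v i x) = x" if "v \<in> pverts G" "x \<in> carrier ?H" for v x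
  proof -
    have "(\<lambda>i. P v i x) = (\<lambda>i. if k v = i then x else \<zero>\<^bsub>?H\<^esub>)" by (auto simp: P_def)
    then show ?thesis
      using H.M.finsum_singleton[of "k v" "{1..n}" "\<lambda>_. x"] k_mem[OF that(1)] that(2)
      by (simp only: finite_atLeastAtMost Pi_I' simp_thms)
  qed
  define p where "p i j v w = (if i = k v \<and> j = k w then 1 else 0 :: real)" for i j v w
  have "p \<in> C_qc TYPE('h) (pverts G) n"
    unfolding C_qc_def mem_Collect_eq
  proof (intro exI[of _ ?H] exI[of _ P] exI[of _ "f 1"] conjI ballI)
    show "hilbert_space ?H" by (rule hilbert_space_complex_line[OF f])
    show "positive_operator ?H (P v i)" "positive_operator ?H (P v i)" for v i by (rule pos)+
    show "(\<Oplus>\<^bsub>?H\<^esub>i\<in>{1..n}. P v i x) = x" "(\<Oplus>\<^bsub>?H\<^esub>i\<in>{1..n}. P v i x) = x"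
      if "v \<in> pverts G" "x \<in> carrier ?H" for v x by (rule sum[OF that])+
    show "P v i (P w j x) = P w j (P v i x)" for v w i j x by (simp add: P_def)
    show "complex_of_real (p i j v w) = ip ?H (P v i (P w j (f 1))) (f 1)" for v w i j
      by (simp add: p_def P_def)
  qed simp_all
  moreover have "p i i v w = 0" if "(v, w) \<in> parcs G" for i v w
  proof -
    have "v \<in> pverts G" "w \<in> pverts G" "v \<noteq> w"
      using that G.in_arcsD1 G.in_arcsD2 G.pair_no_loops[OF that] by auto
    then have "k v \<noteq> k w" using k by (auto simp: bij_betw_def dest: inj_onD)
    then show ?thesis by (simp add: p_def)
  qed
  moreover have "p i j v v = 0" if "i \<noteq> j" for i j v using that by (simp add: p_def)
  ultimately have "qc_colourable TYPE('h) G n"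
    unfolding qc_colourable_def by (intro bexI[of _ p]) auto
  then show ?thesis by blast
qed

text \<open>With no colours the empty sum would be the identity, contradicting the unit vector.\<close>

lemma qc_colourable_pos:
  fixes G :: "'b pair_pre_digraph"
  assumes "qc_colourable TYPE('h) G c" "pverts G \<noteq> {}"
  shows "0 < c"
proof (rule ccontr)
  assume "\<not> 0 < c"
  then have c: "c = 0" by simp
  obtain v where v: "v \<in> pverts G" using assms(2) by blast
  from assms(1) obtain p where "p \<in> C_qc TYPE('h) (pverts G) 0"
    unfolding qc_colourable_def c by blast
  then obtain H :: "'h hilbert" and E :: "'b \<Rightarrow> nat \<Rightarrow> 'h \<Rightarrow> 'h" and \<xi> where H: "hilbert_space H"
    and sum: "\<forall>v\<in>pverts G. \<forall>x\<in>carrier H. (\<Oplus>\<^bsub>H\<^esub>i\<in>{1..0}. E v i x) = x"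
    and \<xi>: "\<xi> \<in> carrier H" "hnorm H \<xi> = 1"
    unfolding C_qc_def mem_Collect_eq by (elim exE conjE) (rule that, assumption+)
  interpret hilbert_space H by (rule H)
  show False using sum v \<xi> hnorm_zero by auto
qed

section \<open>The inequality\<close>

theorem theorem5p12:
  fixes G :: "'v pair_pre_digraph"
  assumes "pair_graph G"
    and "(UNIV :: real set) \<lesssim> (UNIV :: 'a set)"
    and "(UNIV :: real set) \<lesssim> (UNIV :: 'h set)"
  shows "xi_tr TYPE('a) G \<le> ereal (real (chi_qc TYPE('h) G))"
proof -
  define c where "c = chi_qc TYPE('h) G"
  have col: "qc_colourable TYPE('h) G c"
    unfolding c_def chi_qc_def by (rule LeastI_ex[OF qc_colourable_exists[OF assms(1,3)]])
  define S where "S = (SUP u\<in>tracial_values TYPE('a) G. ereal u)"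
  have "1 / S \<le> ereal (real c)"
  proof (cases "pverts G = {}")
    case True
    interpret G: pair_graph G by (rule assms(1))
    have arcs: "parcs G = {}" using True G.in_arcsD1 by auto
    \<comment> \<open>Without vertices the conditions on \<open>u\<close> are void.  In both cases the supremum is infinite and its
      reciprocal \<open>0\<close>.\<close>
    have "tracial_values TYPE('a) G = {} \<or> tracial_values TYPE('a) G = UNIV"
      unfolding tracial_values_def True arcs by auto
    then have "S = -\<infinity> \<or> S = \<infinity>"
    proof
      assume "tracial_values TYPE('a) G = UNIV"
      then have "ereal r \<le> S" for r unfolding S_def by (intro SUP_upper) simp
      then have "S = \<infinity>" by (rule ereal_top)
      then show ?thesis ..
    qed (simp add: S_def bot_ereal_def)
    then show ?thesis by auto
  next
    case False
    have c: "0 < c" by (rule qc_colourable_pos[OF col False])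
    have "ereal (1 / real c) \<le> S"
      unfolding S_def by (rule SUP_upper[OF qc_colouring_tracial_value[OF assms(1,2) c col]])
    then show ?thesis
    proof (cases S)
      case (real r)
      then have r: "1 / real c \<le> r" using \<open>ereal (1 / real c) \<le> S\<close> by simp
      then have "0 < r" using c by (meson divide_pos_pos less_le_trans of_nat_0_less_iff zero_less_one)
      then have "1 / S = ereal (1 / r)" using real by (simp add: one_ereal_def)
      with r c \<open>0 < r\<close> show ?thesis by (simp add: field_simps)
    qed auto
  qed
  then show ?thesis by (simp add: xi_tr_def S_def c_def)
qed

end
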